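(* Let $n\ge 0$ be an integer. (a) The decomposition of $\mathbb{C}P_n$ (acted on by $P_n$ by left multiplication) into $P_n$-invariant subspaces is given by $$\mathbb{C}P_n = \bigoplus_{k=0}^n W^{n,k} = \bigoplus_{k=0}^n\ \bigoplus_{T\subseteq\{1,\dots,n\},\ |T|=k} W^{n,k}_T \ \cong\ \bigoplus_{k=0}^n \binom{n}{k} V^n_k,$$ where the equalities are internal direct sums of $P_n$-invariant subspaces, the isomorphism is one of $P_n$-modules, and $\binom{n}{k}V^n_k$ denotes the direct sum of $\binom nk$ copies of $V^n_k$. (b) The set $\{V^n_k : 0\le k\le n\}$ is a complete set of irreducible $\mathbb{C}P_n$-modules.
   Context: A rook diagram on $n$ is a graph on two rows of $n$ vertices, each row labeled $1,\dots,n$ from left to right, in which every edge joins a top vertex to a bottom vertex and each vertex lies on at most one edge. It corresponds to the $n\times n$ $0$-$1$ matrix having a $1$ in position $(i,j)$ exactly when top vertex $i$ is joined to bottom vertex $j$. The product $d_1d_2$ is the matrix product; equivalently, place $d_1$ above $d_2$, identify the bottom row of $d_1$ with the top row of $d_2$, and keep the edges obtained by composition. A rook diagram is planar if it can be drawn inside the rectangle formed by its vertices without edge crossings. $P_n$ denotes the monoid of planar rook diagrams on $n$, with $P_0=\{\emptyset\}$ the one-element monoid. The rank of a diagram is its number of edges. The planar rook algebra $\mathbb{C}P_n$ is the complex vector space with basis $P_n$ and multiplication extended bilinearly from $P_n$. $\mathbb{C}P_n$-modules (unital) are the same as complex-linear $P_n$-modules; irreducible means nonzero with no proper nonzero invariant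 subspace. A complete set of irreducible modules is a set of pairwise non-isomorphic irreducible modules such that every irreducible module is isomorphic to one of them. For $d\in P_n$, $\tau(d)$ and $\beta(d)$ are the sets of vertices in the top and bottom rows, respectively, that are incident to an edge. View $d$ as the bijection $\beta(d)\to\tau(d)$ sending each bottom vertex to the top vertex it is joined to. For $S\subseteq\beta(d)$ put $d(S)=\{d(s): s\in S\}$. $V^n_k$ is the complex vector space with basis $\{v_S : S\subseteq\{1,\dots,n\},\ |S|=k\}$, with $d\in P_n$ acting linearly by $d v_S = v_{d(S)}$ if $S\subseteq\beta(d)$ and $d v_S=0$ otherwise. For $d',d\in P_n$ write $d'\subseteq d$ if the edge set of $d'$ is a subset of the edge set of $d$, and then $|d\setminus d'|=\mathrm{rank}(d)-\mathrm{rank}(d')$. Define $x_d=\sum_{d'\subseteq d}(-1)^{|d\setminus d'|}d'\in\mathbb{C}P_n$. Define $W^{n,k}=\mathbb{C}\text{-span}\{x_a : a\in P_n,\ \mathrm{rank}(a)=k\}$ and, for $T\subseteq\{1,\dots,n\}$ with $|T|=k$, $W^{n,k}_T=\mathbb{C}\text{-span}\{x_a : a\in P_n,\ \mathrm{rank}(a)=k,\ \beta(a)=T\}$. *)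

theory Defs
  imports "HOL-Analysis.Analysis" "HOL-Library.Poly_Mapping"
begin

section \<open>Planar rook diagrams\<close>

text \<open>A diagram is represented by its set of edges: the pair \<open>(i, j)\<close> is the edge joining
  top vertex \<open>i\<close> to bottom vertex \<open>j\<close>. The number \<open>n\<close> of vertices per row is not part of
  the edge set, so it is a separate argument where it matters.\<close>

type_synonym diagram = "(nat \<times> nat) set"

definition rook_diagram :: "nat \<Rightarrow> diagram \<Rightarrow> bool" where
  "rook_diagram n d \<longleftrightarrow> d \<subseteq> {1..n} \<times> {1..n} \<and> inj_on fst d \<and> inj_on snd d"

text \<open>Top vertex \<open>i\<close> is the point \<open>(i, 1)\<close> and bottom vertex \<open>j\<close> the point \<open>(j, 0)\<close> of the
  plane. The edges are drawn as arbitrary arcs; as distinct edges of a rook diagram have no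
  common vertex, the absence of crossings means that the arcs are pairwise disjoint.\<close>

definition planar :: "nat \<Rightarrow> diagram \<Rightarrow> bool" where
  "planar n d \<longleftrightarrow> (\<exists>\<gamma> :: nat \<times> nat \<Rightarrow> real \<Rightarrow> real \<times> real.
     (\<forall>e\<in>d. arc (\<gamma> e) \<and> pathstart (\<gamma> e) = (real (fst e), 1) \<and> pathfinish (\<gamma> e) = (real (snd e), 0)
            \<and> path_image (\<gamma> e) \<subseteq> cbox (1, 0) (real n, 1)) \<and>
     (\<forall>e\<in>d. \<forall>e'\<in>d. e \<noteq> e' \<longrightarrow> path_image (\<gamma> e) \<inter> path_image (\<gamma> e') = {}))"

definition planar_rook_monoid :: "nat \<Rightarrow> diagram set" where
  "planar_rook_monoid n = {d. rook_diagram n d \<and> planar n d}"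

text \<open>The product of \<open>d1\<close> and \<open>d2\<close> (with \<open>d1\<close> placed on top) is the relational composition
  \<open>d1 O d2\<close>, and the unit is \<open>Id_on {1..n}\<close>.\<close>

abbreviation diagram_rank :: "diagram \<Rightarrow> nat" where
  "diagram_rank d \<equiv> card d"

definition bottom_set :: "diagram \<Rightarrow> nat set" where
  "bottom_set d = snd ` d"

definition diagram_image :: "diagram \<Rightarrow> nat set \<Rightarrow> nat set" where
  "diagram_image d S = {i. \<exists>s\<in>S. (i, s) \<in> d}"


section \<open>Complex vector spaces with a given basis\<close>

text \<open>The complex vector space with basis \<open>B\<close> consists of the finitely supported functions
  with support contained in \<open>B\<close>.\<close>

definition cscale :: "complex \<Rightarrow> ('b \<Rightarrow>\<^sub>0 complex) \<Rightarrow> ('b \<Rightarrow>\<^sub>0 complex)" where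
  "cscale c f = Poly_Mapping.map ((*) c) f"

lemma lookup_cscale [simp]: "Poly_Mapping.lookup (cscale c f) b = c * Poly_Mapping.lookup f b"
  by (simp add: cscale_def Poly_Mapping.map.rep_eq when_def)

interpretation cspace: vector_space cscale
  by unfold_locales (auto intro!: poly_mapping_eqI simp: lookup_add algebra_simps)

definition free_cspace :: "'b set \<Rightarrow> ('b \<Rightarrow>\<^sub>0 complex) set" where
  "free_cspace B = {f. Poly_Mapping.keys f \<subseteq> B}"

abbreviation basis_vector :: "'b \<Rightarrow> ('b \<Rightarrow>\<^sub>0 complex)" where
  "basis_vector b \<equiv> Poly_Mapping.single b 1"

definition linear_extension ::
  "('a \<Rightarrow> ('b \<Rightarrow>\<^sub>0 complex)) \<Rightarrow> ('a \<Rightarrow>\<^sub>0 complex) \<Rightarrow> ('b \<Rightarrow>\<^sub>0 complex)" where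
  "linear_extension h f = (\<Sum>a\<in>Poly_Mapping.keys f. cscale (Poly_Mapping.lookup f a) (h a))"


section \<open>Modules over the planar rook monoid\<close>

text \<open>A complex-linear \<open>P\<^sub>n\<close>-module (equivalently, a unital module over the planar rook algebra)
  with underlying space \<open>M\<close>, a subspace of an ambient complex vector space. Only the values of
  the action \<open>act\<close> on diagrams of the monoid and vectors of \<open>M\<close> matter.\<close>

locale planar_rook_module = vector_space scl
  for n :: nat
  and scl :: "complex \<Rightarrow> 'm :: ab_group_add \<Rightarrow> 'm"
  and M :: "'m set"
  and act :: "diagram \<Rightarrow> 'm \<Rightarrow> 'm" +
  assumes subspace_carrier: "subspace M"
    and act_closed: "\<lbrakk>d \<in> planar_rook_monoid n; v \<in> M\<rbrakk> \<Longrightarrow> act d v \<in> M"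
    and act_add: "\<lbrakk>d \<in> planar_rook_monoid n; v \<in> M; w \<in> M\<rbrakk> \<Longrightarrow> act d (v + w) = act d v + act d w"
    and act_scale: "\<lbrakk>d \<in> planar_rook_monoid n; v \<in> M\<rbrakk> \<Longrightarrow> act d (scl c v) = scl c (act d v)"
    and act_unit: "v \<in> M \<Longrightarrow> act (Id_on {1..n}) v = v"
    and act_mult: "\<lbrakk>d1 \<in> planar_rook_monoid n; d2 \<in> planar_rook_monoid n; v \<in> M\<rbrakk>
      \<Longrightarrow> act (d1 O d2) v = act d1 (act d2 v)"

definition invariant_subspace ::
  "nat \<Rightarrow> (complex \<Rightarrow> 'm :: ab_group_add \<Rightarrow> 'm) \<Rightarrow> 'm set \<Rightarrow> (diagram \<Rightarrow> 'm \<Rightarrow> 'm) \<Rightarrow> 'm set \<Rightarrow> bool" where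
  "invariant_subspace n scl M act N \<longleftrightarrow>
     N \<subseteq> M \<and> module.subspace scl N \<and> (\<forall>d\<in>planar_rook_monoid n. \<forall>v\<in>N. act d v \<in> N)"

definition irreducible_module ::
  "nat \<Rightarrow> (complex \<Rightarrow> 'm :: ab_group_add \<Rightarrow> 'm) \<Rightarrow> 'm set \<Rightarrow> (diagram \<Rightarrow> 'm \<Rightarrow> 'm) \<Rightarrow> bool" where
  "irreducible_module n scl M act \<longleftrightarrow>
     planar_rook_module n scl M act \<and> M \<noteq> {0} \<and>
     (\<forall>N. invariant_subspace n scl M act N \<longrightarrow> N = {0} \<or> N = M)"

definition isomorphic_modules ::
  "nat \<Rightarrow> (complex \<Rightarrow> 'a :: ab_group_add \<Rightarrow> 'a) \<Rightarrow> 'a set \<Rightarrow> (diagram \<Rightarrow> 'a \<Rightarrow> 'a)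
       \<Rightarrow> (complex \<Rightarrow> 'b :: ab_group_add \<Rightarrow> 'b) \<Rightarrow> 'b set \<Rightarrow> (diagram \<Rightarrow> 'b \<Rightarrow> 'b) \<Rightarrow> bool" where
  "isomorphic_modules n scl M act scl' M' act' \<longleftrightarrow>
     (\<exists>\<phi>. bij_betw \<phi> M M' \<and>
          (\<forall>v\<in>M. \<forall>w\<in>M. \<phi> (v + w) = \<phi> v + \<phi> w) \<and>
          (\<forall>c. \<forall>v\<in>M. \<phi> (scl c v) = scl' c (\<phi> v)) \<and>
          (\<forall>d\<in>planar_rook_monoid n. \<forall>v\<in>M. \<phi> (act d v) = act' d (\<phi> v)))"

text \<open>\<open>M\<close> is the internal direct sum of the finite family \<open>U\<close>: every element of \<open>M\<close> is
  \<open>\<Sum>i\<in>I. u i\<close> for exactly one family \<open>u\<close> with \<open>u i \<in> U i\<close>, and all these sums lie in \<open>M\<close>.\<close>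

definition internal_direct_sum :: "'m :: ab_group_add set \<Rightarrow> 'i set \<Rightarrow> ('i \<Rightarrow> 'm set) \<Rightarrow> bool" where
  "internal_direct_sum M I U \<longleftrightarrow>
     finite I \<and> bij_betw (\<lambda>u. \<Sum>i\<in>I. u i) (\<Pi>\<^sub>E i\<in>I. U i) M"

text \<open>The external direct sum consists of the finitely supported families, with componentwise
  operations. \<open>Poly_Mapping.map\<close> applies its argument only to nonzero components, which does not
  matter for maps sending \<open>0\<close> to \<open>0\<close>.\<close>

definition external_direct_sum :: "'i set \<Rightarrow> ('i \<Rightarrow> 'm :: ab_group_add set) \<Rightarrow> ('i \<Rightarrow>\<^sub>0 'm) set" where
  "external_direct_sum I U =
     {f. Poly_Mapping.keys f \<subseteq> I \<and> (\<forall>i\<in>I. Poly_Mapping.lookup f i \<in> U i)}"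

definition sum_scale :: "(complex \<Rightarrow> 'm :: ab_group_add \<Rightarrow> 'm) \<Rightarrow> complex \<Rightarrow> ('i \<Rightarrow>\<^sub>0 'm) \<Rightarrow> ('i \<Rightarrow>\<^sub>0 'm)" where
  "sum_scale scl c = Poly_Mapping.map (scl c)"

definition sum_act :: "(diagram \<Rightarrow> 'm :: ab_group_add \<Rightarrow> 'm) \<Rightarrow> diagram \<Rightarrow> ('i \<Rightarrow>\<^sub>0 'm) \<Rightarrow> ('i \<Rightarrow>\<^sub>0 'm)" where
  "sum_act act d = Poly_Mapping.map (act d)"


section \<open>The planar rook algebra\<close>

definition planar_rook_algebra :: "nat \<Rightarrow> (diagram \<Rightarrow>\<^sub>0 complex) set" where
  "planar_rook_algebra n = free_cspace (planar_rook_monoid n)"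

definition algebra_mult ::
  "(diagram \<Rightarrow>\<^sub>0 complex) \<Rightarrow> (diagram \<Rightarrow>\<^sub>0 complex) \<Rightarrow> (diagram \<Rightarrow>\<^sub>0 complex)" where
  "algebra_mult f g = linear_extension (\<lambda>d1. linear_extension (\<lambda>d2. basis_vector (d1 O d2)) g) f"

definition left_act :: "diagram \<Rightarrow> (diagram \<Rightarrow>\<^sub>0 complex) \<Rightarrow> (diagram \<Rightarrow>\<^sub>0 complex)" where
  "left_act d f = algebra_mult (basis_vector d) f"

definition x_elem :: "nat \<Rightarrow> diagram \<Rightarrow> (diagram \<Rightarrow>\<^sub>0 complex)" where
  "x_elem n d = (\<Sum>d' | d' \<in> planar_rook_monoid n \<and> d' \<subseteq> d.
     cscale ((- 1) ^ (diagram_rank d - diagram_rank d')) (basis_vector d'))"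

definition W_space :: "nat \<Rightarrow> nat \<Rightarrow> (diagram \<Rightarrow>\<^sub>0 complex) set" where
  "W_space n k = cspace.span {x_elem n a |a. a \<in> planar_rook_monoid n \<and> diagram_rank a = k}"

definition W_bottom_space :: "nat \<Rightarrow> nat \<Rightarrow> nat set \<Rightarrow> (diagram \<Rightarrow>\<^sub>0 complex) set" where
  "W_bottom_space n k T = cspace.span
     {x_elem n a |a. a \<in> planar_rook_monoid n \<and> diagram_rank a = k \<and> bottom_set a = T}"


section \<open>The modules \<open>V\<^sup>n\<^sub>k\<close>\<close>

definition k_subsets :: "nat \<Rightarrow> nat \<Rightarrow> nat set set" where
  "k_subsets n k = {S. S \<subseteq> {1..n} \<and> card S = k}"

definition V_module :: "nat \<Rightarrow> nat \<Rightarrow> (nat set \<Rightarrow>\<^sub>0 complex) set" where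
  "V_module n k = free_cspace (k_subsets n k)"

definition V_act :: "diagram \<Rightarrow> (nat set \<Rightarrow>\<^sub>0 complex) \<Rightarrow> (nat set \<Rightarrow>\<^sub>0 complex)" where
  "V_act d = linear_extension
     (\<lambda>S. if S \<subseteq> bottom_set d then basis_vector (diagram_image d S) else 0)"

end

theory Submission
  imports Defs
begin

text \<open>
  The theorem rests on a description of planar diagrams by order, on alternating sums that behave
  like matrix units in every module, and on the irreducibility of the modules \<open>V_module n k\<close>.

  Planarity is monotonicity. By a Jordan-type crossing argument, two disjoint edges inside the
  rectangle cannot change their order between top and bottom; conversely, edges in increasing order
  can be drawn as straight lines (\<open>planar_rook_monoid_iff\<close>). Consequently a planar diagram is
  determined by its sets of top and bottom vertices, and any two sets of equal size occur
  (\<open>diagram_of\<close>, \<open>diagram_eqI\<close>).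

  Alternating sums are matrix units. In any module, replace the action of a diagram \<open>a\<close> by the
  alternating sum \<open>alternating_act a\<close> over its subdiagrams, which in the algebra is multiplication by
  \<open>x_elem n a\<close>. If every edge of \<open>a\<close> can be prolonged through \<open>d\<close>, then \<open>d\<close> takes the alternating sum of
  \<open>a\<close> to that of \<open>d O a\<close> (\<open>act_alternating_act\<close>); otherwise the terms cancel in pairs and the result is \<open>0\<close>
  (\<open>act_alternating_act_eq_0\<close>). This is precisely how diagrams act on the basis of
  \<open>V_module n k\<close>. For a fixed bottom set \<open>T\<close> with \<open>k\<close> elements, every vector \<open>v\<close> of a module therefore gives a
  homomorphism from \<open>V_module n k\<close> that takes the basis vector at \<open>S\<close> to
  \<open>alternating_act (diagram_of S T) v\<close>.

  The modules \<open>V_module n k\<close> are irreducible, because \<open>diagram_of S T\<close> acts on them as a matrix unit. So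
  such a homomorphism is either zero or injective (\<open>V_isomorphic_span_alternating_act\<close>).

  Taking the unit of the algebra for \<open>v\<close> yields \<open>V_module n k \<cong> W_bottom_space n k T\<close>. The elements
  \<open>x_elem n a\<close> form a basis of the algebra, since they are unitriangular with respect to the diagrams,
  and grouping this basis by rank and bottom set gives all the direct sums. Taking a
  nonzero vector of an irreducible module for \<open>v\<close>, some alternating sum of \<open>v\<close> is nonzero because
  the identity acts as a combination of alternating sums; this
  gives an isomorphism with some \<open>V_module n k\<close>. Different \<open>k\<close> are told apart by a diagram of
  the smaller rank, which annihilates only the module with the larger index.\<close>

section \<open>Planarity is monotonicity of the edges\<close>

text \<open>The library's theorem on paths joining opposite sides of a box lives in \<open>real^2\<close>, while
  diagrams are drawn in \<open>real \<times> real\<close>; a linear homeomorphism carries it over.\<close>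

lemma crossing_paths_in_box:
  fixes f g :: "real \<Rightarrow> real \<times> real"
  assumes "path f" "path g"
    and f_box: "path_image f \<subseteq> cbox (a1, a2) (b1, b2)"
    and g_box: "path_image g \<subseteq> cbox (a1, a2) (b1, b2)"
    and "fst (pathstart f) = a1" "fst (pathfinish f) = b1"
    and "snd (pathstart g) = a2" "snd (pathfinish g) = b2"
  obtains z where "z \<in> path_image f" "z \<in> path_image g"
proof -
  define h :: "real \<times> real \<Rightarrow> real^2" where "h p = vector [fst p, snd p]" for p
  have h_nth: "h p $ 1 = fst p" "h p $ 2 = snd p" for p
    by (simp_all add: h_def)
  have h_alt: "h p = (\<chi> i. if i = 1 then fst p else snd p)" for p
    by (simp add: h_def vec_eq_iff forall_2)
  have cont: "continuous_on S h" for S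
    unfolding h_alt
  proof (rule continuous_on_vec_lambda)
    show "continuous_on S (\<lambda>p. if i = 1 then fst p else snd p)" for i :: 2
      by (cases "i = 1") (auto intro: continuous_intros)
  qed
  have inj: "p = q" if "h p = h q" for p q
    using that h_nth by (metis prod_eqI)
  have box: "h ` cbox (a1, a2) (b1, b2) \<subseteq> cbox (h (a1, a2)) (h (b1, b2))"
    by (auto simp: mem_box_cart forall_2 h_nth cbox_Pair_eq)
  obtain z where "z \<in> path_image (h \<circ> f)" "z \<in> path_image (h \<circ> g)"
  proof (rule fashoda[of "h \<circ> f" "h \<circ> g" "h (a1, a2)" "h (b1, b2)"])
    show "path (h \<circ> f)" "path (h \<circ> g)"
      using assms(1,2) cont by (auto intro: path_continuous_image)
    show "path_image (h \<circ> f) \<subseteq> cbox (h (a1, a2)) (h (b1, b2))"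
      "path_image (h \<circ> g) \<subseteq> cbox (h (a1, a2)) (h (b1, b2))"
      using f_box g_box box unfolding path_image_compose by blast+
  qed (use assms in \<open>auto simp: pathstart_compose pathfinish_compose h_nth\<close>)
  then show thesis
    using that inj unfolding path_image_compose by blast
qed

text \<open>Edges whose ends come in opposite orders at the top and at the bottom must meet. Both paths are
  prolonged outside the strip \<open>0 \<le> y \<le> 1\<close>: the first runs in from the left wall and out to the
  right wall, the second runs straight up and down to the top and the bottom wall of a larger box.
  The prolonged paths meet, and if the edges were disjoint, the prolongations could not be
  responsible: they avoid each other, and they touch the strip only in endpoints of their own edge.\<close>

lemma reversed_endpoints_cross:
  fixes p q :: "real \<Rightarrow> real \<times> real"
  assumes "path p" "path q"
    and p_ends: "pathstart p = (i, 1)" "pathfinish p = (j, 0)"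
    and q_ends: "pathstart q = (i', 1)" "pathfinish q = (j', 0)"
    and p_box: "path_image p \<subseteq> cbox (1, 0) (b, 1)"
    and q_box: "path_image q \<subseteq> cbox (1, 0) (b, 1)"
    and "i < i'" "j' < j"
  shows "path_image p \<inter> path_image q \<noteq> {}"
proof
  assume disjoint: "path_image p \<inter> path_image q = {}"
  \<comment> \<open>The path \<open>f\<close> travels sideways at the heights \<open>2\<close> and \<open>-1\<close>. There \<open>g\<close> has first coordinate \<open>i'\<close>,
    to the right of the part of \<open>f\<close> at height \<open>2\<close>, and \<open>j'\<close>, to the left of the part at height \<open>-1\<close>.\<close>
  define f where "f = linepath (0, 2) (i, 2) +++ linepath (i, 2) (i, 1) +++ p
    +++ linepath (j, 0) (j, - 1) +++ linepath (j, - 1) (b + 1, - 1)"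
  define g where "g = linepath (i', 3) (i', 1) +++ q +++ linepath (j', 0) (j', - 2)"
  have ends: "(i, 1) \<in> path_image p" "(j, 0) \<in> path_image p"
    "(i', 1) \<in> path_image q" "(j', 0) \<in> path_image q"
    using p_ends q_ends pathstart_in_path_image pathfinish_in_path_image by metis+
  have bounds: "1 \<le> i" "i \<le> b" "1 \<le> j" "j \<le> b" "1 \<le> i'" "i' \<le> b" "1 \<le> j'" "j' \<le> b"
    using ends p_box q_box by (auto simp: cbox_Pair_eq)
  have f_image: "path_image f = closed_segment (0, 2) (i, 2) \<union> closed_segment (i, 2) (i, 1)
      \<union> path_image p \<union> closed_segment (j, 0) (j, - 1) \<union> closed_segment (j, - 1) (b + 1, - 1)"
    unfolding f_def using p_ends by (simp add: path_image_join Un_assoc)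
  have g_image: "path_image g = closed_segment (i', 3) (i', 1)
      \<union> path_image q \<union> closed_segment (j', 0) (j', - 2)"
    unfolding g_def using q_ends by (simp add: path_image_join Un_assoc)
  have cbox_mem: "(x, y) \<in> cbox (l1, l2) (u1, u2) \<longleftrightarrow> l1 \<le> x \<and> x \<le> u1 \<and> l2 \<le> y \<and> y \<le> u2"
    for x y l1 l2 u1 u2 :: real
    by (auto simp: cbox_Pair_eq)
  have box_mono: "cbox (1, 0) (b, 1) \<subseteq> cbox (0, - 2) (b + 1, 3 :: real)"
    by (auto simp: cbox_Pair_eq)
  obtain z where "z \<in> path_image f" "z \<in> path_image (reversepath g)"
  proof (rule crossing_paths_in_box[of f "reversepath g" 0 "- 2" "b + 1" 3])
    show "path f" "path (reversepath g)"
      unfolding f_def g_def using assms by (auto intro!: path_join_imp)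
    show "path_image f \<subseteq> cbox (0, - 2) (b + 1, 3)"
      unfolding f_image using bounds p_box box_mono
      by (intro Un_least closed_segment_subset convex_box) (auto simp: cbox_mem)
    show "path_image (reversepath g) \<subseteq> cbox (0, - 2) (b + 1, 3)"
      unfolding path_image_reversepath g_image using bounds q_box box_mono
      by (intro Un_least closed_segment_subset convex_box) (auto simp: cbox_mem)
  qed (simp_all add: f_def g_def)
  then obtain x y where f: "(x, y) \<in> path_image f" and g: "(x, y) \<in> path_image g"
    by (cases z) auto
  have segment: "(x, y) \<in> closed_segment (a1, a2) (b1, b2) \<Longrightarrow>
      min a1 b1 \<le> x \<and> x \<le> max a1 b1 \<and> min a2 b2 \<le> y \<and> y \<le> max a2 b2" for a1 a2 b1 b2
    by (drule closed_segment_PairD) (auto simp: closed_segment_eq_real_ivl split: if_splits)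
  have p: "0 \<le> y \<and> y \<le> 1 \<and> (x = i' \<longrightarrow> y < 1) \<and> (x = j' \<longrightarrow> 0 < y)"
    if "(x, y) \<in> path_image p"
  proof -
    have "(x, y) \<noteq> (i', 1)" "(x, y) \<noteq> (j', 0)"
      using that ends disjoint by auto
    moreover have "(x, y) \<in> cbox (1, 0) (b, 1)" using that p_box by blast
    ultimately show ?thesis by (auto simp: cbox_mem)
  qed
  have q: "0 \<le> y \<and> y \<le> 1 \<and> (x = i \<longrightarrow> y < 1) \<and> (x = j \<longrightarrow> 0 < y)"
    if "(x, y) \<in> path_image q"
  proof -
    have "(x, y) \<noteq> (i, 1)" "(x, y) \<noteq> (j, 0)"
      using that ends disjoint by auto
    moreover have "(x, y) \<in> cbox (1, 0) (b, 1)" using that q_box by blast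
    ultimately show ?thesis by (auto simp: cbox_mem)
  qed
  have f_cases: "x \<le> i \<and> y = 2 \<or> x = i \<and> 1 \<le> y \<and> y \<le> 2 \<or> (x, y) \<in> path_image p
      \<or> x = j \<and> - 1 \<le> y \<and> y \<le> 0 \<or> j \<le> x \<and> y = - 1"
    using f bounds unfolding f_image Un_iff
    by (elim disjE) (auto dest: segment)
  have g_cases: "x = i' \<and> 1 \<le> y \<or> (x, y) \<in> path_image q \<or> x = j' \<and> y \<le> 0"
    using g bounds unfolding g_image Un_iff
    by (elim disjE) (auto dest: segment)
  show False
  proof (cases "(x, y) \<in> path_image p")
    case True
    then have "(x, y) \<notin> path_image q" using disjoint by blast
    then show False using g_cases p[OF True] by auto
  next
    case not_p: False
    show False
    proof (cases "(x, y) \<in> path_image q")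
      case True
      then show False using f_cases not_p q[OF True] by auto
    next
      case False
      then show False
        using f_cases g_cases not_p \<open>i < i'\<close> \<open>j' < j\<close> by (elim disjE conjE) simp_all
    qed
  qed
qed

text \<open>Stating the order condition as an equivalence makes it imply the injectivity of both
  projections, so that no separate condition for rook diagrams remains.\<close>

definition increasing_edges :: "diagram \<Rightarrow> bool" where
  "increasing_edges d \<longleftrightarrow> (\<forall>(i, j)\<in>d. \<forall>(i', j')\<in>d. i < i' \<longleftrightarrow> j < j')"

text \<open>At a common height the horizontal distance of the two segments is a convex combination of the
  positive numbers \<open>i' - i\<close> and \<open>j' - j\<close>.\<close>

lemma segments_disjoint:
  fixes i j i' j' :: real
  assumes "i < i'" "j < j'"
  shows "closed_segment (i, 1) (j, 0) \<inter> closed_segment (i', 1) (j', 0 :: real) = {}"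
proof -
  have "False" if "(1 - t) * i + t * j = (1 - t) * i' + t * j'" "0 \<le> t" "t \<le> 1" for t :: real
  proof -
    have "(1 - t) * (i' - i) + t * (j' - j) = 0"
      using that(1) by (simp add: algebra_simps)
    moreover have "(1 - t) * (i' - i) \<ge> 0" "t * (j' - j) \<ge> 0"
      using that assms by auto
    ultimately have "(1 - t) * (i' - i) = 0" "t * (j' - j) = 0"
      by linarith+
    then show False using assms by auto
  qed
  then show ?thesis
    by (auto simp: closed_segment_def)
qed

text \<open>After this characterisation the drawings disappear from the proof: crossing edges are excluded
  by the crossing argument above, and increasing edges can be drawn as straight lines.\<close>

lemma planar_rook_monoid_iff:
  "d \<in> planar_rook_monoid n \<longleftrightarrow> d \<subseteq> {1..n} \<times> {1..n} \<and> increasing_edges d"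
proof
  assume "d \<in> planar_rook_monoid n"
  then have sub: "d \<subseteq> {1..n} \<times> {1..n}" and inj: "inj_on fst d" "inj_on snd d" and "planar n d"
    by (auto simp: planar_rook_monoid_def rook_diagram_def)
  then obtain \<gamma> :: "nat \<times> nat \<Rightarrow> real \<Rightarrow> real \<times> real" where
    \<gamma>: "\<forall>e\<in>d. arc (\<gamma> e) \<and> pathstart (\<gamma> e) = (real (fst e), 1) \<and> pathfinish (\<gamma> e) = (real (snd e), 0)
      \<and> path_image (\<gamma> e) \<subseteq> cbox (1, 0) (real n, 1)"
    and disj: "\<forall>e\<in>d. \<forall>e'\<in>d. e \<noteq> e' \<longrightarrow> path_image (\<gamma> e) \<inter> path_image (\<gamma> e') = {}"
    unfolding planar_def by (elim exE conjE)
  have less: "j < j'" if "(i, j) \<in> d" "(i', j') \<in> d" "i < i'" for i j i' j'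
  proof (rule ccontr)
    assume "\<not> j < j'"
    moreover have "j \<noteq> j'"
      using that inj_onD[OF inj(2), of "(i, j)" "(i', j')"] by auto
    ultimately have "j' < j" by simp
    then have "path_image (\<gamma> (i, j)) \<inter> path_image (\<gamma> (i', j')) \<noteq> {}"
      using that \<gamma>[rule_format, OF that(1)] \<gamma>[rule_format, OF that(2)]
      by (intro reversed_endpoints_cross[of _ _ "real i" "real j" "real i'" "real j'" "real n"])
        (auto intro: arc_imp_path)
    moreover have "(i, j) \<noteq> (i', j')" using that by simp
    ultimately show False
      using disj that(1,2) by blast
  qed
  have "increasing_edges d"
    unfolding increasing_edges_def
  proof safe
    fix i j i' j' assume edges: "(i, j) \<in> d" "(i', j') \<in> d" and "j < j'"
    then show "i < i'"
      using less[OF edges(2,1)] inj_onD[OF inj(1), of "(i, j)" "(i', j')"] by fastforce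
  qed (use less in auto)
  with sub show "d \<subseteq> {1..n} \<times> {1..n} \<and> increasing_edges d" by simp
next
  assume *: "d \<subseteq> {1..n} \<times> {1..n} \<and> increasing_edges d"
  then have inc: "\<And>i j i' j'. \<lbrakk>(i, j) \<in> d; (i', j') \<in> d\<rbrakk> \<Longrightarrow> i < i' \<longleftrightarrow> j < j'"
    by (auto simp: increasing_edges_def)
  have "inj_on fst d" "inj_on snd d"
    using inc by (auto simp: inj_on_def) (metis less_irrefl nat_neq_iff)+
  moreover have "planar n d"
    unfolding planar_def
  proof (intro exI conjI ballI impI)
    let ?\<gamma> = "\<lambda>e. linepath (real (fst e), 1) (real (snd e), 0 :: real)"
    fix e assume e: "e \<in> d"
    then show "arc (?\<gamma> e)" "pathstart (?\<gamma> e) = (real (fst e), 1)"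
      "pathfinish (?\<gamma> e) = (real (snd e), 0)"
      by (auto intro: arc_linepath)
    show "path_image (?\<gamma> e) \<subseteq> cbox (1, 0) (real n, 1)"
      unfolding path_image_linepath using e *
      by (intro closed_segment_subset convex_box) (auto simp: cbox_Pair_eq)
    fix e' assume e': "e' \<in> d" and "e \<noteq> e'"
    with e inc[of "fst e" "snd e" "fst e'" "snd e'"] inc[of "fst e'" "snd e'" "fst e" "snd e"]
    have "fst e < fst e' \<and> snd e < snd e' \<or> fst e' < fst e \<and> snd e' < snd e"
      by (metis linorder_neq_iff prod.collapse)
    then show "path_image (?\<gamma> e) \<inter> path_image (?\<gamma> e') = {}"
      using segments_disjoint[of "real (fst e)" "real (fst e')" "real (snd e)" "real (snd e')"]
        segments_disjoint[of "real (fst e')" "real (fst e)" "real (snd e')" "real (snd e)"]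
      by auto
  qed
  ultimately show "d \<in> planar_rook_monoid n"
    using * by (simp add: planar_rook_monoid_def rook_diagram_def)
qed


section \<open>Combinatorics of planar rook diagrams\<close>

lemma planar_rook_monoid_less_iff:
  "\<lbrakk>d \<in> planar_rook_monoid n; (i, j) \<in> d; (i', j') \<in> d\<rbrakk> \<Longrightarrow> i < i' \<longleftrightarrow> j < j'"
  by (auto simp: planar_rook_monoid_iff increasing_edges_def)

lemma planar_rook_monoid_top_unique:
  "\<lbrakk>d \<in> planar_rook_monoid n; (i, j) \<in> d; (i', j) \<in> d\<rbrakk> \<Longrightarrow> i = i'"
  by (metis less_irrefl linorder_neq_iff planar_rook_monoid_less_iff)

lemma planar_rook_monoid_inj:
  assumes "d \<in> planar_rook_monoid n"
  shows "inj_on fst d" "inj_on snd d"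
  using assms by (simp_all add: planar_rook_monoid_def rook_diagram_def)

lemma finite_planar_rook_monoid: "finite (planar_rook_monoid n)"
  by (rule finite_subset[of _ "Pow ({1..n} \<times> {1..n})"]) (auto simp only: planar_rook_monoid_iff Pow_iff)

lemma finite_diagram: "d \<in> planar_rook_monoid n \<Longrightarrow> finite d"
  by (rule finite_subset[of _ "{1..n} \<times> {1..n}"]) (simp_all only: planar_rook_monoid_iff finite_SigmaI finite_atLeastAtMost)

lemma planar_rook_monoid_subset: "\<lbrakk>d \<in> planar_rook_monoid n; d' \<subseteq> d\<rbrakk> \<Longrightarrow> d' \<in> planar_rook_monoid n"
  unfolding planar_rook_monoid_iff increasing_edges_def by blast

lemma planar_rook_monoid_comp:
  assumes "d1 \<in> planar_rook_monoid n" "d2 \<in> planar_rook_monoid n"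
  shows "d1 O d2 \<in> planar_rook_monoid n"
proof -
  have "i < i' \<longleftrightarrow> k < k'"
    if "(i, j) \<in> d1" "(j, k) \<in> d2" "(i', j') \<in> d1" "(j', k') \<in> d2" for i j k i' j' k'
    using that assms planar_rook_monoid_less_iff by metis
  then show ?thesis
    using assms by (auto simp: planar_rook_monoid_iff increasing_edges_def)
qed

lemma planar_rook_monoid_Id: "Id_on {1..n} \<in> planar_rook_monoid n"
  by (auto simp: planar_rook_monoid_iff increasing_edges_def)

lemma diagram_comp_Id: "d \<in> planar_rook_monoid n \<Longrightarrow> d O Id_on {1..n} = d"
  by (fastforce simp: planar_rook_monoid_iff)

lemma Id_diagram_comp: "d \<in> planar_rook_monoid n \<Longrightarrow> Id_on {1..n} O d = d"
  by (fastforce simp: planar_rook_monoid_iff)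

lemma bottom_set_subset: "d \<in> planar_rook_monoid n \<Longrightarrow> bottom_set d \<subseteq> {1..n}"
  by (auto simp: planar_rook_monoid_iff bottom_set_def)

lemma diagram_top_subset: "d \<in> planar_rook_monoid n \<Longrightarrow> fst ` d \<subseteq> {1..n}"
  by (auto simp: planar_rook_monoid_iff)

lemma card_diagram_eq:
  assumes "d \<in> planar_rook_monoid n"
  shows "card (fst ` d) = diagram_rank d" "card (bottom_set d) = diagram_rank d"
  using planar_rook_monoid_inj[OF assms] by (simp_all add: card_image bottom_set_def)

lemma diagram_rank_le: "d \<in> planar_rook_monoid n \<Longrightarrow> diagram_rank d \<le> n"
  using card_mono[OF finite_atLeastAtMost bottom_set_subset, of d n] card_diagram_eq(2)[of d n] by simp

definition diagram_of :: "nat set \<Rightarrow> nat set \<Rightarrow> diagram" where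
  "diagram_of S T = (\<lambda>m. (enumerate S m, enumerate T m)) ` {..<card S}"

lemma diagram_of:
  assumes "S \<in> k_subsets n k" "T \<in> k_subsets n k"
  shows diagram_of_in_monoid: "diagram_of S T \<in> planar_rook_monoid n"
    and fst_diagram_of: "fst ` diagram_of S T = S"
    and bottom_set_diagram_of: "bottom_set (diagram_of S T) = T"
    and diagram_rank_diagram_of: "diagram_rank (diagram_of S T) = k"
proof -
  have ST: "finite S" "finite T" "card S = k" "card T = k" "S \<subseteq> {1..n}" "T \<subseteq> {1..n}"
    using assms by (auto simp: k_subsets_def intro: finite_subset)
  have "enumerate S ` {..<card S} = S" "enumerate T ` {..<card T} = T"
    using bij_betw_imp_surj_on[OF finite_bij_enumerate[OF ST(1)]]
      bij_betw_imp_surj_on[OF finite_bij_enumerate[OF ST(2)]] ST by simp_all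
  then show *: "fst ` diagram_of S T = S" "bottom_set (diagram_of S T) = T"
    using ST by (simp_all add: diagram_of_def bottom_set_def image_image)
  have "increasing_edges (diagram_of S T)"
    using ST by (auto simp: increasing_edges_def diagram_of_def)
  moreover have "diagram_of S T \<subseteq> S \<times> T"
    using * by (force simp: bottom_set_def)
  ultimately show "diagram_of S T \<in> planar_rook_monoid n"
    using ST by (auto simp: planar_rook_monoid_iff)
  then show "diagram_rank (diagram_of S T) = k"
    using card_diagram_eq(1) * ST by fastforce
qed

text \<open>The edges on the left of a given edge are the same at the top and at the bottom. This makes a planar diagram recoverable from its two vertex sets.\<close>

lemma edge_positions_agree:
  assumes "d \<in> planar_rook_monoid n" "(i, j) \<in> d"
  shows "card {s \<in> fst ` d. s < i} = card {t \<in> bottom_set d. t < j}"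
proof -
  let ?E = "{e \<in> d. fst e < i}"
  have E: "?E = {e \<in> d. snd e < j}"
    using planar_rook_monoid_less_iff[OF assms(1)] assms(2) by auto
  have "{s \<in> fst ` d. s < i} = fst ` ?E" "{t \<in> bottom_set d. t < j} = snd ` ?E"
    unfolding bottom_set_def by auto (use E in force)+
  then show ?thesis
    using planar_rook_monoid_inj[OF assms(1)]
    by (simp add: card_image inj_on_subset[of _ d])
qed

lemma card_less_inject:
  fixes T :: "nat set"
  assumes "finite T" "t \<in> T" "t' \<in> T" "card {s \<in> T. s < t} = card {s \<in> T. s < t'}"
  shows "t = t'"
proof -
  have "card {s \<in> T. s < t} < card {s \<in> T. s < t'}" if "t < t'" "t \<in> T" for t t'
    by (rule psubset_card_mono) (use that assms(1) in auto)
  from this[of t t'] this[of t' t] show ?thesis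
    using assms by (cases t t' rule: linorder_cases) simp_all
qed

text \<open>The reason why the representation theory is that of matrices over \<open>\<complex>\<close>: between two sets of
  equal size there is exactly one planar diagram, so no nontrivial symmetric group enters.\<close>

lemma diagram_eqI:
  assumes "d \<in> planar_rook_monoid n" "d' \<in> planar_rook_monoid n"
    and "fst ` d = fst ` d'" "bottom_set d = bottom_set d'"
  shows "d = d'"
proof -
  have sub: "d \<subseteq> d'" if "d \<in> planar_rook_monoid n" "d' \<in> planar_rook_monoid n"
    and top: "fst ` d = fst ` d'" and bottom: "bottom_set d = bottom_set d'" for d d'
  proof
    fix e assume e: "e \<in> d"
    obtain j' where j': "(fst e, j') \<in> d'"
      using top e by (metis imageE image_eqI prod.collapse)
    have "snd e = j'"
    proof (rule card_less_inject[of "bottom_set d"])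
      show "finite (bottom_set d)"
        using finite_diagram that by (auto simp: bottom_set_def)
      show "snd e \<in> bottom_set d" using e by (simp add: bottom_set_def)
      show "j' \<in> bottom_set d" unfolding bottom using j' by (force simp: bottom_set_def)
      show "card {s \<in> bottom_set d. s < snd e} = card {s \<in> bottom_set d. s < j'}"
        using edge_positions_agree[OF that(1), of "fst e" "snd e"] edge_positions_agree[OF that(2) j']
          e top bottom by simp
    qed
    then show "e \<in> d'" using j' by auto
  qed
  show ?thesis
    using sub[of d d'] sub[of d' d] assms by auto
qed

lemma diagram_eq_diagram_of:
  assumes "d \<in> planar_rook_monoid n"
  shows "d = diagram_of (fst ` d) (bottom_set d)"
    and "fst ` d \<in> k_subsets n (diagram_rank d)" "bottom_set d \<in> k_subsets n (diagram_rank d)"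
proof -
  show *: "fst ` d \<in> k_subsets n (diagram_rank d)" "bottom_set d \<in> k_subsets n (diagram_rank d)"
    using assms diagram_top_subset bottom_set_subset card_diagram_eq by (simp_all add: k_subsets_def)
  show "d = diagram_of (fst ` d) (bottom_set d)"
    using diagram_eqI[OF assms] diagram_of[OF *] by metis
qed

text \<open>The edge of the product \<open>d O a\<close> that prolongs the edge \<open>e\<close> of \<open>a\<close> through \<open>d\<close>; it is
  meaningful only if the top vertex of \<open>e\<close> is a used bottom vertex of \<open>d\<close>.\<close>

definition push_edge :: "diagram \<Rightarrow> nat \<times> nat \<Rightarrow> nat \<times> nat" where
  "push_edge d e = (THE i. (i, fst e) \<in> d, snd e)"

text \<open>If every edge of \<open>a\<close> survives in the product, then multiplication by \<open>d\<close> identifies the lattice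
  of subdiagrams of \<open>a\<close> with that of \<open>d O a\<close> and preserves ranks.\<close>

lemma push_edge:
  assumes d: "d \<in> planar_rook_monoid n" and a: "a \<in> planar_rook_monoid n"
    and composable: "fst ` a \<subseteq> bottom_set d"
  shows inj_on_push_edge: "inj_on (push_edge d) a"
    and diagram_comp_eq_image: "b \<subseteq> a \<Longrightarrow> d O b = push_edge d ` b"
proof -
  have the: "(THE i'. (i', j) \<in> d) = i" if "(i, j) \<in> d" for i j
    using planar_rook_monoid_top_unique[OF d] that by blast
  show "inj_on (push_edge d) a"
    using planar_rook_monoid_inj(2)[OF a] by (auto simp: inj_on_def push_edge_def)
  show "d O b = push_edge d ` b" if "b \<subseteq> a"
  proof
    show "push_edge d ` b \<subseteq> d O b"
    proof
      fix x assume "x \<in> push_edge d ` b"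
      then obtain j k where jk: "(j, k) \<in> b" "x = push_edge d (j, k)" by auto
      then obtain i where "(i, j) \<in> d"
        using composable \<open>b \<subseteq> a\<close> by (force simp: bottom_set_def)
      then show "x \<in> d O b"
        using jk the by (auto simp: push_edge_def)
    qed
    show "d O b \<subseteq> push_edge d ` b"
    proof
      fix x assume "x \<in> d O b"
      then obtain i j k where "x = (i, k)" "(i, j) \<in> d" "(j, k) \<in> b" by auto
      then show "x \<in> push_edge d ` b"
        using the by (intro image_eqI[of _ _ "(j, k)"]) (auto simp: push_edge_def)
    qed
  qed
qed

lemma diagram_rank_comp:
  assumes "d \<in> planar_rook_monoid n" "a \<in> planar_rook_monoid n" "fst ` a \<subseteq> bottom_set d"
  shows "diagram_rank (d O a) = diagram_rank a"
  using push_edge[OF assms] by (simp add: card_image)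

lemma bottom_set_comp:
  assumes "fst ` a \<subseteq> bottom_set d"
  shows "bottom_set (d O a) = bottom_set a"
  using assms by (force simp: bottom_set_def)

lemma fst_comp: "fst ` (d O a) = diagram_image d (fst ` a)"
  by (force simp: diagram_image_def)

text \<open>A set \<open>S\<close> is treated as the idempotent diagram \<open>diagram_of S S\<close>, for which the rank of a
  product is known.\<close>

lemma diagram_image_in_k_subsets:
  assumes d: "d \<in> planar_rook_monoid n" and S: "S \<in> k_subsets n k" "S \<subseteq> bottom_set d"
  shows "diagram_image d S \<in> k_subsets n k"
proof -
  have SS: "diagram_of S S \<in> planar_rook_monoid n" "fst ` diagram_of S S = S" "card (diagram_of S S) = k"
    using diagram_of[OF S(1) S(1)] by auto
  then have "d O diagram_of S S \<in> planar_rook_monoid n" "card (d O diagram_of S S) = k"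
    using planar_rook_monoid_comp[OF d] diagram_rank_comp[OF d SS(1)] S by auto
  then show ?thesis
    using diagram_eq_diagram_of(2) SS(2) fst_comp by metis
qed

lemma comp_diagram_of:
  assumes d: "d \<in> planar_rook_monoid n" and S: "S \<in> k_subsets n k" "S \<subseteq> bottom_set d"
    and T: "T \<in> k_subsets n k"
  shows "d O diagram_of S T = diagram_of (diagram_image d S) T"
proof (rule diagram_eqI)
  note ST = diagram_of[OF S(1) T]
  note dS = diagram_of[OF diagram_image_in_k_subsets[OF d S] T]
  show "d O diagram_of S T \<in> planar_rook_monoid n"
    by (rule planar_rook_monoid_comp[OF d ST(1)])
  show "diagram_of (diagram_image d S) T \<in> planar_rook_monoid n"
    by (rule dS)
  show "fst ` (d O diagram_of S T) = fst ` diagram_of (diagram_image d S) T"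
    using ST dS by (simp add: fst_comp)
  show "bottom_set (d O diagram_of S T) = bottom_set (diagram_of (diagram_image d S) T)"
    using ST dS S by (simp add: bottom_set_comp)
qed

lemma diagram_image_bottom_set: "diagram_image d (bottom_set d) = fst ` d"
  by (force simp: diagram_image_def bottom_set_def)

lemma k_subset_eqI:
  assumes "S \<in> k_subsets n k" "T \<in> k_subsets n k" "S \<subseteq> T"
  shows "S = T"
  using assms finite_subset[of T "{1..n}"] card_subset_eq[of T S] by (simp add: k_subsets_def)

lemma finite_k_subsets: "finite (k_subsets n k)" and card_k_subsets: "card (k_subsets n k) = n choose k"
  unfolding k_subsets_def using n_subsets[of "{1..n}" k] by auto

lemma k_subsets_nonempty: "k \<le> n \<Longrightarrow> k_subsets n k \<noteq> {}"
  using card_k_subsets[of n k] by (metis card.empty neq0_conv zero_less_binomial_iff)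


section \<open>Linear maps out of a space with a given basis\<close>

text \<open>The linear extension of \<open>h\<close> with values in an arbitrary complex vector space, as needed for
  maps into an irreducible module about whose elements nothing is known.\<close>

definition lift_basis :: "(complex \<Rightarrow> 'm \<Rightarrow> 'm) \<Rightarrow> ('b \<Rightarrow> 'm) \<Rightarrow> ('b \<Rightarrow>\<^sub>0 complex) \<Rightarrow> 'm :: ab_group_add" where
  "lift_basis scl h f = (\<Sum>b\<in>Poly_Mapping.keys f. scl (Poly_Mapping.lookup f b) (h b))"

lemma linear_extension_eq_lift_basis: "linear_extension = lift_basis cscale"
  by (intro ext) (simp add: linear_extension_def lift_basis_def)

lemma lift_basis_superset:
  assumes "vector_space scl" "finite A" "Poly_Mapping.keys f \<subseteq> A"
  shows "lift_basis scl h f = (\<Sum>b\<in>A. scl (Poly_Mapping.lookup f b) (h b))"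
proof -
  interpret vector_space scl by fact
  show ?thesis
    unfolding lift_basis_def using assms
    by (intro sum.mono_neutral_left) (auto simp: in_keys_iff)
qed

lemma linear_lift_basis:
  fixes h :: "'b \<Rightarrow> 'm :: ab_group_add"
  assumes "vector_space scl"
  shows "Vector_Spaces.linear cscale scl (lift_basis scl h)"
proof -
  interpret target: vector_space scl by fact
  show ?thesis
  proof unfold_locales
    fix f g :: "'b \<Rightarrow>\<^sub>0 complex"
    let ?A = "Poly_Mapping.keys f \<union> Poly_Mapping.keys g"
    have "Poly_Mapping.keys (f + g) \<subseteq> ?A"
      by (rule keys_add)
    then show "lift_basis scl h (f + g) = lift_basis scl h f + lift_basis scl h g"
      by (simp add: lift_basis_superset[OF assms, of ?A] lookup_add target.scale_left_distrib sum.distrib)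
  next
    fix c and f :: "'b \<Rightarrow>\<^sub>0 complex"
    have "Poly_Mapping.keys (cscale c f) \<subseteq> Poly_Mapping.keys f"
      by (auto simp: in_keys_iff)
    then show "lift_basis scl h (cscale c f) = scl c (lift_basis scl h f)"
      by (simp add: lift_basis_superset[OF assms, of "Poly_Mapping.keys f"] target.scale_sum_right)
  qed
qed

lemma lift_basis_basis_vector [simp]:
  "vector_space scl \<Longrightarrow> lift_basis scl h (basis_vector b) = h b"
  by (simp add: lift_basis_superset[of scl "{b}"] vector_space.vector_space_assms)

lemma subspace_free_cspace: "cspace.subspace (free_cspace B)"
proof (rule cspace.subspaceI)
  show "f + g \<in> free_cspace B" if "f \<in> free_cspace B" "g \<in> free_cspace B" for f g
    using that keys_add[of f g] by (auto simp: free_cspace_def)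
  show "cscale c f \<in> free_cspace B" if "f \<in> free_cspace B" for c f
    using that by (auto simp: free_cspace_def in_keys_iff subset_iff)
qed (simp add: free_cspace_def)

lemma basis_vector_in_free_cspace: "b \<in> B \<Longrightarrow> basis_vector b \<in> free_cspace B"
  by (simp add: free_cspace_def)

lemma sum_basis_vectors: "f = (\<Sum>b\<in>Poly_Mapping.keys f. cscale (Poly_Mapping.lookup f b) (basis_vector b))"
proof (rule poly_mapping_eqI)
  fix k
  show "Poly_Mapping.lookup f k = Poly_Mapping.lookup
      (\<Sum>b\<in>Poly_Mapping.keys f. cscale (Poly_Mapping.lookup f b) (basis_vector b)) k"
    by (simp add: lookup_sum lookup_single when_def sum.delta if_distrib in_keys_iff
        cong: if_cong)
qed

lemma free_cspace_eq_span: "free_cspace B = cspace.span (basis_vector ` B)"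
proof
  show "free_cspace B \<subseteq> cspace.span (basis_vector ` B)"
  proof
    fix f assume "f \<in> free_cspace B"
    then have "(\<Sum>b\<in>Poly_Mapping.keys f. cscale (Poly_Mapping.lookup f b) (basis_vector b))
        \<in> cspace.span (basis_vector ` B)"
      by (intro cspace.span_sum cspace.span_scale cspace.span_base) (auto simp: free_cspace_def)
    then show "f \<in> cspace.span (basis_vector ` B)"
      using sum_basis_vectors[of f] by simp
  qed
  show "cspace.span (basis_vector ` B) \<subseteq> free_cspace B"
    by (rule cspace.span_minimal) (auto simp: subspace_free_cspace basis_vector_in_free_cspace)
qed

lemma free_cspace_induct [consumes 1, case_names zero step]:
  assumes "f \<in> free_cspace B"
    and "P 0"
    and "\<And>c b g. \<lbrakk>b \<in> B; g \<in> free_cspace B; P g\<rbrakk> \<Longrightarrow> P (cscale c (basis_vector b) + g)"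
  shows "P f"
proof -
  have "f \<in> free_cspace B \<and> P f"
    using assms(1) unfolding free_cspace_eq_span
  proof (induction rule: cspace.span_induct_alt)
    case base
    then show ?case by (simp add: assms(2) cspace.span_zero)
  next
    case (step c x y)
    then show ?case
      using assms(3) by (auto simp: free_cspace_eq_span intro: cspace.span_add cspace.span_scale cspace.span_base)
  qed
  then show ?thesis by simp
qed

text \<open>It suffices to check the module laws on a basis. Both \<open>planar_rook_algebra n\<close> and
  \<open>V_module n k\<close> are obtained in this way.\<close>

lemma free_planar_rook_module:
  assumes closed: "\<And>d b. \<lbrakk>d \<in> planar_rook_monoid n; b \<in> B\<rbrakk> \<Longrightarrow> h d b \<in> free_cspace B"
    and unit: "\<And>b. b \<in> B \<Longrightarrow> h (Id_on {1..n}) b = basis_vector b"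
    and mult: "\<And>d1 d2 b. \<lbrakk>d1 \<in> planar_rook_monoid n; d2 \<in> planar_rook_monoid n; b \<in> B\<rbrakk>
      \<Longrightarrow> linear_extension (h d1) (h d2 b) = h (d1 O d2) b"
  shows "planar_rook_module n cscale (free_cspace B) (\<lambda>d. linear_extension (h d))"
proof -
  interpret Vector_Spaces.linear cscale cscale "linear_extension (h d)" for d
    unfolding linear_extension_eq_lift_basis
    by (rule linear_lift_basis) (rule cspace.vector_space_axioms)
  have basis: "linear_extension (h d) (basis_vector b) = h d b" for d b
    by (simp add: linear_extension_eq_lift_basis cspace.vector_space_axioms)
  show ?thesis
  proof unfold_locales
    show "cspace.subspace (free_cspace B)" by (rule subspace_free_cspace)
    show "linear_extension (h d) v \<in> free_cspace B"
      if "v \<in> free_cspace B" "d \<in> planar_rook_monoid n" for d v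
      using that
      by (induction rule: free_cspace_induct)
        (auto simp: add scale zero basis closed intro!: cspace.subspace_add cspace.subspace_scale
          cspace.subspace_0 subspace_free_cspace)
    show "linear_extension (h (Id_on {1..n})) v = v" if "v \<in> free_cspace B" for v
      using that by (induction rule: free_cspace_induct) (simp_all only: add scale zero basis unit)
    show "linear_extension (h (d1 O d2)) v = linear_extension (h d1) (linear_extension (h d2) v)"
      if "v \<in> free_cspace B" "d1 \<in> planar_rook_monoid n" "d2 \<in> planar_rook_monoid n" for d1 d2 v
      using that by (induction rule: free_cspace_induct) (simp_all only: add scale zero basis mult)
  qed (simp_all only: add scale)
qed


section \<open>Alternating sums in modules over the planar rook monoid\<close>

context planar_rook_module
begin

lemma zero_in_carrier: "0 \<in> M"
  using subspace_carrier by (rule subspace_0)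

lemma act_zero: "d \<in> planar_rook_monoid n \<Longrightarrow> act d 0 = 0"
  using act_scale[of d 0 0] zero_in_carrier by simp

lemma act_sum:
  assumes d: "d \<in> planar_rook_monoid n" and "\<And>i. i \<in> I \<Longrightarrow> f i \<in> M"
  shows "act d (\<Sum>i\<in>I. f i) = (\<Sum>i\<in>I. act d (f i))"
  using assms(2)
proof (induction I rule: infinite_finite_induct)
  case (insert i I)
  then show ?case
    using d by (simp add: act_add subspace_sum[OF subspace_carrier])
qed (simp_all add: act_zero[OF d])

text \<open>In the planar rook algebra this is multiplication by \<open>x_elem n a\<close>. It is defined in every
  module, so that the decomposition of the algebra and the classification of irreducible modules
  rest on the same computation.\<close>

definition alternating_act :: "diagram \<Rightarrow> 'm \<Rightarrow> 'm" where
  "alternating_act a v = (\<Sum>b\<in>Pow a. scl ((- 1) ^ (card a - card b)) (act b v))"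

lemma alternating_act_closed:
  assumes "a \<in> planar_rook_monoid n" "v \<in> M"
  shows "alternating_act a v \<in> M"
  unfolding alternating_act_def using assms planar_rook_monoid_subset
  by (intro subspace_sum[OF subspace_carrier] subspace_scale[OF subspace_carrier] act_closed) auto

lemma act_alternating_act_expand:
  assumes "d \<in> planar_rook_monoid n" "a \<in> planar_rook_monoid n" "v \<in> M"
  shows "act d (alternating_act a v) = (\<Sum>b\<in>Pow a. scl ((- 1) ^ (card a - card b)) (act (d O b) v))"
proof -
  have b: "b \<in> planar_rook_monoid n" if "b \<in> Pow a" for b
    using that assms(2) planar_rook_monoid_subset by blast
  have "act d (alternating_act a v) = (\<Sum>b\<in>Pow a. act d (scl ((- 1) ^ (card a - card b)) (act b v)))"
    unfolding alternating_act_def using assms b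
    by (intro act_sum) (auto intro!: subspace_scale[OF subspace_carrier] act_closed)
  also have "\<dots> = (\<Sum>b\<in>Pow a. scl ((- 1) ^ (card a - card b)) (act (d O b) v))"
    using assms b by (intro sum.cong refl) (simp add: act_scale act_closed act_mult)
  finally show ?thesis .
qed

text \<open>The substitution \<open>b \<mapsto> d O b\<close> is a rank preserving bijection between the subdiagrams of \<open>a\<close>
  and those of \<open>d O a\<close>, hence turns one alternating sum into the other.\<close>

lemma act_alternating_act:
  assumes d: "d \<in> planar_rook_monoid n" and a: "a \<in> planar_rook_monoid n" and "v \<in> M"
    and composable: "fst ` a \<subseteq> bottom_set d"
  shows "act d (alternating_act a v) = alternating_act (d O a) v"
proof -
  note push = push_edge[OF d a composable]
  have image: "Pow (d O a) = (\<lambda>b. d O b) ` Pow a"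
    using push(2) by (auto simp: image_Pow_surj[symmetric])
  have card: "card (d O b) = card b" if "b \<in> Pow a" for b
    using that push by (simp add: card_image inj_on_subset[of "push_edge d" a b])
  have inj: "inj_on (\<lambda>b. d O b) (Pow a)"
    using inj_on_image_Pow[OF push(1)] push(2) by (simp add: inj_on_def)
  show ?thesis
    unfolding act_alternating_act_expand[OF d a \<open>v \<in> M\<close>]
    unfolding alternating_act_def image sum.reindex[OF inj]
    using card by simp
qed

text \<open>If some edge of \<open>a\<close> does not survive in the product with \<open>d\<close>, then adding or removing this edge
  pairs the subdiagrams of \<open>a\<close> such that the two members of a pair have the same product with \<open>d\<close>
  but opposite signs.\<close>

lemma act_alternating_act_eq_0:
  assumes d: "d \<in> planar_rook_monoid n" and a: "a \<in> planar_rook_monoid n" and "v \<in> M"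
    and not_composable: "\<not> fst ` a \<subseteq> bottom_set d"
  shows "act d (alternating_act a v) = 0"
proof -
  obtain i j where e: "(i, j) \<in> a" "i \<notin> bottom_set d"
    using not_composable by (metis imageE prod.collapse subsetI)
  define a' where "a' = a - {(i, j)}"
  have a_eq: "a = insert (i, j) a'" and not_in: "(i, j) \<notin> a'" and fin: "finite a'"
    using e finite_diagram[OF a] by (auto simp: a'_def)
  let ?g = "\<lambda>b. scl ((- 1) ^ (card a - card b)) (act (d O b) v)"
  \<comment> \<open>The bottom vertex \<open>i\<close> of \<open>d\<close> carries no edge, so the edge \<open>(i, j)\<close> leaves no trace in the product.\<close>
  have cancel: "?g (insert (i, j) b) = - ?g b" if "b \<in> Pow a'" for b
  proof -
    have b: "finite b" "(i, j) \<notin> b" "card b \<le> card a'"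
      using that not_in fin by (auto intro: finite_subset card_mono)
    have "d O insert (i, j) b = d O b"
      using e by (force simp: bottom_set_def)
    moreover have "card a - card b = Suc (card a - card (insert (i, j) b))"
      using b not_in fin by (simp add: a_eq)
    ultimately show ?thesis
      by simp
  qed
  have "inj_on (insert (i, j)) (Pow a')"
    using not_in by (intro inj_onI, subst (asm) insert_ident) auto
  then have "sum ?g (insert (i, j) ` Pow a') = - sum ?g (Pow a')"
    using cancel by (simp add: sum.reindex sum_negf)
  moreover have "Pow a' \<inter> insert (i, j) ` Pow a' = {}"
    using not_in by auto
  ultimately have "sum ?g (Pow a) = 0"
    using fin unfolding a_eq Pow_insert by (subst sum.union_disjoint) (simp_all flip: a_eq)
  then show ?thesis
    by (simp add: act_alternating_act_expand[OF d a \<open>v \<in> M\<close>])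
qed

text \<open>The alternating sum over the subdiagrams of \<open>d\<close> contains \<open>d\<close> with coefficient \<open>1\<close> and otherwise
  only smaller diagrams, so it can be solved for \<open>d\<close> by induction on the rank. Applied to the
  identity, this shows that every vector is a combination of its alternating sums.\<close>

lemma act_in_span_alternating_act:
  assumes "d \<in> planar_rook_monoid n" "v \<in> M"
  shows "act d v \<in> span ((\<lambda>a. alternating_act a v) ` Pow d)"
  using assms(1)
proof (induction "card d" arbitrary: d rule: less_induct)
  case less
  let ?X = "\<lambda>d. span ((\<lambda>a. alternating_act a v) ` Pow d)"
  have fin: "finite d"
    using finite_diagram less.prems .
  have "act b v \<in> ?X d" if "b \<in> Pow d - {d}" for b
  proof -
    have "act b v \<in> ?X b"
      using that fin less.prems planar_rook_monoid_subset
      by (intro less.hyps) (auto intro: psubset_card_mono)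
    moreover have "?X b \<subseteq> ?X d"
      using that by (intro span_mono image_mono Pow_mono) simp
    ultimately show ?thesis by blast
  qed
  then have rest: "(\<Sum>b\<in>Pow d - {d}. scl ((- 1) ^ (card d - card b)) (act b v)) \<in> ?X d"
    by (intro span_sum span_scale)
  have "alternating_act d v \<in> ?X d"
    by (rule span_base) simp
  from span_diff[OF this rest]
  have "alternating_act d v - (\<Sum>b\<in>Pow d - {d}. scl ((- 1) ^ (card d - card b)) (act b v)) \<in> ?X d" .
  moreover have "alternating_act d v = act d v
      + (\<Sum>b\<in>Pow d - {d}. scl ((- 1) ^ (card d - card b)) (act b v))"
    unfolding alternating_act_def using fin by (subst sum.remove[of _ d]) simp_all
  ultimately show ?case by simp
qed

lemma invariant_span_alternating_act:
  assumes "v \<in> M" "A \<subseteq> planar_rook_monoid n"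
    and A: "\<And>d a. \<lbrakk>d \<in> planar_rook_monoid n; a \<in> A; fst ` a \<subseteq> bottom_set d\<rbrakk> \<Longrightarrow> d O a \<in> A"
  shows "invariant_subspace n scl M act (span ((\<lambda>a. alternating_act a v) ` A))" (is "invariant_subspace n scl M act ?N")
proof -
  have sub: "?N \<subseteq> M"
    using assms alternating_act_closed by (intro span_minimal subspace_carrier) auto
  have "w \<in> ?N \<and> act d w \<in> ?N" if d: "d \<in> planar_rook_monoid n" and "w \<in> ?N" for d w
    using \<open>w \<in> ?N\<close>
  proof (induction rule: span_induct_alt)
    case base
    then show ?case by (simp add: act_zero d span_zero)
  next
    case (step c x y)
    then obtain a where a: "a \<in> A" "x = alternating_act a v" by auto
    have "act d x \<in> ?N"
    proof (cases "fst ` a \<subseteq> bottom_set d")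
      case True
      then show ?thesis
        using a assms d by (auto simp: act_alternating_act subset_iff intro!: span_base)
    next
      case False
      then show ?thesis
        using a assms d by (auto simp: act_alternating_act_eq_0 subset_iff span_zero)
    qed
    have "x \<in> ?N" using step by (auto intro: span_base)
    moreover from this have "x \<in> M" "y \<in> M" using sub step by auto
    ultimately show ?case
      using \<open>act d x \<in> ?N\<close> step d
      by (simp add: act_add act_scale subspace_scale[OF subspace_carrier] span_add span_scale)
  qed
  then show ?thesis
    using sub by (simp add: invariant_subspace_def subspace_span)
qed

end


section \<open>The irreducible modules\<close>

text \<open>Closedness of the source is what makes the inverse map compatible with the operations: it
  allows sums, multiples and images in the source to be recognised as preimages.\<close>

lemma isomorphic_modules_sym:
  assumes closed: "\<And>v w. \<lbrakk>v \<in> M; w \<in> M\<rbrakk> \<Longrightarrow> v + w \<in> M" "\<And>c v. v \<in> M \<Longrightarrow> scl c v \<in> M"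
      "\<And>d v. \<lbrakk>d \<in> planar_rook_monoid n; v \<in> M\<rbrakk> \<Longrightarrow> act d v \<in> M"
    and "isomorphic_modules n scl M act scl' M' act'"
  shows "isomorphic_modules n scl' M' act' scl M act"
proof -
  obtain \<phi> where bij: "bij_betw \<phi> M M'"
    and add: "\<And>v w. \<lbrakk>v \<in> M; w \<in> M\<rbrakk> \<Longrightarrow> \<phi> (v + w) = \<phi> v + \<phi> w"
    and scale: "\<And>c v. v \<in> M \<Longrightarrow> \<phi> (scl c v) = scl' c (\<phi> v)"
    and act: "\<And>d v. \<lbrakk>d \<in> planar_rook_monoid n; v \<in> M\<rbrakk> \<Longrightarrow> \<phi> (act d v) = act' d (\<phi> v)"
    using assms(4) unfolding isomorphic_modules_def by blast
  define \<psi> where "\<psi> = inv_into M \<phi>"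
  have \<psi>: "\<psi> v \<in> M" "\<phi> (\<psi> v) = v" if "v \<in> M'" for v
    using bij that unfolding \<psi>_def
    by (metis bij_betw_imp_surj_on inv_into_into, metis bij_betw_imp_surj_on f_inv_into_f)
  have \<psi>_eq: "\<psi> (\<phi> v) = v" if "v \<in> M" for v
    using bij that by (simp add: \<psi>_def bij_betw_inv_into_left)
  show ?thesis
    unfolding isomorphic_modules_def
  proof (intro exI[of _ \<psi>] conjI ballI allI)
    show "bij_betw \<psi> M' M"
      using bij by (simp add: \<psi>_def bij_betw_inv_into)
    show "\<psi> (v + w) = \<psi> v + \<psi> w" if "v \<in> M'" "w \<in> M'" for v w
      using \<psi>[OF that(1)] \<psi>[OF that(2)] add \<psi>_eq closed by metis
    show "\<psi> (scl' c v) = scl c (\<psi> v)" if "v \<in> M'" for c v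
      using \<psi>[OF that] scale \<psi>_eq closed by metis
    show "\<psi> (act' d v) = act d (\<psi> v)" if "d \<in> planar_rook_monoid n" "v \<in> M'" for d v
      using \<psi>[OF that(2)] act[OF that(1)] \<psi>_eq closed(3)[OF that(1)] by metis
  qed
qed

lemma (in planar_rook_module) isomorphic_sym:
  "isomorphic_modules n scl M act scl' M' act' \<Longrightarrow> isomorphic_modules n scl' M' act' scl M act"
  by (rule isomorphic_modules_sym)
    (auto intro: subspace_add[OF subspace_carrier] subspace_scale[OF subspace_carrier] act_closed)


definition V_generator_act :: "diagram \<Rightarrow> nat set \<Rightarrow> (nat set \<Rightarrow>\<^sub>0 complex)" where
  "V_generator_act d S = (if S \<subseteq> bottom_set d then basis_vector (diagram_image d S) else 0)"

lemma V_act_eq: "V_act = (\<lambda>d. linear_extension (V_generator_act d))"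
  by (intro ext) (simp add: V_act_def V_generator_act_def[abs_def])

lemma linear_V_act: "Vector_Spaces.linear cscale cscale (V_act d)"
  unfolding V_act_eq linear_extension_eq_lift_basis
  by (rule linear_lift_basis) (rule cspace.vector_space_axioms)

lemma V_act_zero: "V_act d 0 = 0"
  by (simp add: V_act_def linear_extension_def)

lemma V_act_basis_vector: "V_act d (basis_vector S) = V_generator_act d S"
  by (simp add: V_act_eq linear_extension_eq_lift_basis cspace.vector_space_axioms)

lemma subset_bottom_set_comp:
  assumes "d2 \<in> planar_rook_monoid n"
  shows "S \<subseteq> bottom_set (d1 O d2) \<longleftrightarrow> S \<subseteq> bottom_set d2 \<and> diagram_image d2 S \<subseteq> bottom_set d1"
proof safe
  fix s assume S: "S \<subseteq> bottom_set (d1 O d2)"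
  show "s \<in> bottom_set d2" if "s \<in> S"
    using S that by (force simp: bottom_set_def)
  show "s \<in> bottom_set d1" if s: "s \<in> diagram_image d2 S"
  proof -
    from s obtain t where t: "t \<in> S" "(s, t) \<in> d2"
      by (auto simp: diagram_image_def)
    with S obtain i j where "(i, j) \<in> d1" "(j, t) \<in> d2"
      by (force simp: bottom_set_def)
    then show ?thesis
      using planar_rook_monoid_top_unique[OF assms t(2)] by (force simp: bottom_set_def)
  qed
next
  fix s assume "S \<subseteq> bottom_set d2" "diagram_image d2 S \<subseteq> bottom_set d1" and s: "s \<in> S"
  then obtain j i where "(j, s) \<in> d2" "(i, j) \<in> d1"
    by (force simp: bottom_set_def diagram_image_def)
  then show "s \<in> bottom_set (d1 O d2)"
    by (force simp: bottom_set_def)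
qed

lemma diagram_image_comp: "diagram_image (d1 O d2) S = diagram_image d1 (diagram_image d2 S)"
  by (auto simp: diagram_image_def)

lemma V_planar_rook_module: "planar_rook_module n cscale (V_module n k) V_act"
  unfolding V_module_def V_act_eq
proof (rule free_planar_rook_module)
  show "V_generator_act d S \<in> free_cspace (k_subsets n k)"
    if "d \<in> planar_rook_monoid n" "S \<in> k_subsets n k" for d S
    using diagram_image_in_k_subsets[OF that]
    by (auto simp: V_generator_act_def basis_vector_in_free_cspace cspace.subspace_0 subspace_free_cspace)
  show "V_generator_act (Id_on {1..n}) S = basis_vector S" if "S \<in> k_subsets n k" for S
  proof -
    have "S \<subseteq> bottom_set (Id_on {1..n})" "diagram_image (Id_on {1..n}) S = S"
      using that by (force simp: k_subsets_def bottom_set_def diagram_image_def Id_on_def)+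
    then show ?thesis by (simp add: V_generator_act_def)
  qed
  show "linear_extension (V_generator_act d1) (V_generator_act d2 S) = V_generator_act (d1 O d2) S"
    if "d2 \<in> planar_rook_monoid n" for d1 d2 S
    using V_act_basis_vector[of d1] V_act_zero[of d1]
    by (auto simp: V_generator_act_def subset_bottom_set_comp[OF that] diagram_image_comp
        simp flip: V_act_eq[THEN fun_cong])
qed

text \<open>On \<open>k\<close>-subsets, \<open>diagram_of S T\<close> acts as the matrix unit at position \<open>(S, T)\<close>: another set
  \<open>U\<close> of \<open>k\<close> elements cannot be contained in \<open>T\<close>.\<close>

lemma V_act_diagram_of:
  assumes S: "S \<in> k_subsets n k" and T: "T \<in> k_subsets n k" and "f \<in> V_module n k"
  shows "V_act (diagram_of S T) f = cscale (Poly_Mapping.lookup f T) (basis_vector S)"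
  using assms(3) unfolding V_module_def
proof (induction rule: free_cspace_induct)
  case zero
  then show ?case by (simp add: V_act_zero)
next
  case (step c U g)
  interpret Vector_Spaces.linear cscale cscale "V_act (diagram_of S T)" by (rule linear_V_act)
  have "V_act (diagram_of S T) (basis_vector U) = (if U = T then basis_vector S else 0)"
    using k_subset_eqI[OF step(1) T] diagram_image_bottom_set[of "diagram_of S T"]
    by (auto simp: V_act_basis_vector V_generator_act_def bottom_set_diagram_of[OF S T] fst_diagram_of[OF S T])
  then show ?case
    by (simp add: add scale step lookup_add lookup_single cspace.scale_left_distrib)
qed

text \<open>From any nonzero vector some matrix unit produces a nonzero multiple of any chosen basis vector.\<close>

lemma V_module_irreducible:
  assumes "k \<le> n"
  shows "irreducible_module n cscale (V_module n k) V_act"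
  unfolding irreducible_module_def
proof (intro conjI allI impI)
  show "planar_rook_module n cscale (V_module n k) V_act"
    by (rule V_planar_rook_module)
  obtain S where "S \<in> k_subsets n k"
    using k_subsets_nonempty[OF assms] by auto
  then have "basis_vector S \<in> V_module n k"
    by (simp add: V_module_def basis_vector_in_free_cspace)
  then show "V_module n k \<noteq> {0}"
    by (metis lookup_single_eq lookup_zero singletonD zero_neq_one)
  fix N assume N: "invariant_subspace n cscale (V_module n k) V_act N"
  have "V_module n k \<subseteq> N" if "N \<noteq> {0}"
  proof -
    have sub: "N \<subseteq> V_module n k" "cspace.subspace N"
      using N by (auto simp: invariant_subspace_def)
    have "\<not> N \<subseteq> {0}"
      using \<open>N \<noteq> {0}\<close> cspace.subspace_0[OF sub(2)] by blast
    then obtain f where f: "f \<in> N" "f \<noteq> 0" by blast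
    then obtain T where T: "T \<in> Poly_Mapping.keys f"
      using poly_mapping_eqI[of f 0] by (metis in_keys_iff lookup_zero)
    then have T_sub: "T \<in> k_subsets n k"
      using f sub by (auto simp: V_module_def free_cspace_def)
    have "basis_vector S \<in> N" if S: "S \<in> k_subsets n k" for S
    proof -
      have "V_act (diagram_of S T) f \<in> N"
        using N f diagram_of_in_monoid[OF S T_sub] by (simp add: invariant_subspace_def)
      then have "cscale (inverse (Poly_Mapping.lookup f T)) (V_act (diagram_of S T) f) \<in> N"
        using sub by (intro cspace.subspace_scale)
      then show ?thesis
        using T f sub V_act_diagram_of[OF S T_sub, of f] by (auto simp: in_keys_iff)
    qed
    then show ?thesis
      unfolding V_module_def free_cspace_eq_span using sub(2) by (intro cspace.span_minimal) auto
  qed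
  then show "N = {0} \<or> N = V_module n k"
    using N by (auto simp: invariant_subspace_def)
qed

text \<open>A diagram of rank \<open>min k l\<close> annihilates the module with the larger index but not the other.\<close>

lemma V_modules_not_isomorphic:
  assumes "k \<le> n" "l \<le> n" "k \<noteq> l"
  shows "\<not> isomorphic_modules n cscale (V_module n k) V_act cscale (V_module n l) V_act"
proof -
  have less: "\<not> isomorphic_modules n cscale (V_module n k) V_act cscale (V_module n l) V_act"
    if k: "k \<le> n" and kl: "k < l" for k l
  proof
    assume "isomorphic_modules n cscale (V_module n k) V_act cscale (V_module n l) V_act"
    then obtain \<phi> where bij: "bij_betw \<phi> (V_module n k) (V_module n l)"
      and act: "\<And>d v. \<lbrakk>d \<in> planar_rook_monoid n; v \<in> V_module n k\<rbrakk> \<Longrightarrow> \<phi> (V_act d v) = V_act d (\<phi> v)"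
      unfolding isomorphic_modules_def by blast
    obtain S where S: "S \<in> k_subsets n k"
      using k_subsets_nonempty[OF k] by auto
    let ?d = "diagram_of S S"
    have d: "?d \<in> planar_rook_monoid n" by (rule diagram_of_in_monoid[OF S S])
    have kill: "V_act ?d f = 0" if "f \<in> V_module n l" for f
      using that unfolding V_module_def
    proof (induction rule: free_cspace_induct)
      case zero
      then show ?case by (simp add: V_act_zero)
    next
      case (step c U g)
      interpret Vector_Spaces.linear cscale cscale "V_act ?d" by (rule linear_V_act)
      have "\<not> U \<subseteq> S"
        using step(1) S kl card_mono[of S U] finite_subset[of S "{1..n}"] by (auto simp: k_subsets_def)
      then show ?case
        by (simp add: add scale step V_act_basis_vector V_generator_act_def bottom_set_diagram_of[OF S S])
    qed
    have v: "basis_vector S \<in> V_module n k" "0 \<in> V_module n k"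
      using S by (simp_all add: V_module_def basis_vector_in_free_cspace cspace.subspace_0 subspace_free_cspace)
    have fixed: "V_act ?d (basis_vector S) = basis_vector S"
      using V_act_diagram_of[OF S S v(1)] by simp
    have in_l: "\<phi> v \<in> V_module n l" if "v \<in> V_module n k" for v
      using bij that by (auto simp: bij_betw_def)
    have "\<phi> (basis_vector S) = 0"
      using act[OF d v(1)] kill[OF in_l[OF v(1)]] fixed by simp
    moreover have "\<phi> 0 = 0"
      using act[OF d v(2)] kill[OF in_l[OF v(2)]] by (simp add: V_act_zero)
    ultimately have "basis_vector S = 0"
      using bij v unfolding bij_betw_def inj_on_def by metis
    then show False
      by (metis lookup_single_eq lookup_zero zero_neq_one)
  qed
  show ?thesis
  proof (cases "k < l")
    case False
    then show ?thesis
      using less[of l k] assms planar_rook_module.isomorphic_sym[OF V_planar_rook_module, of n k cscale "V_module n l" V_act]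
      by auto
  qed (use less assms in auto)
qed

lemma diagrams_with_bottom_set:
  assumes T: "T \<in> k_subsets n k"
  shows "{a \<in> planar_rook_monoid n. diagram_rank a = k \<and> bottom_set a = T}
    = (\<lambda>S. diagram_of S T) ` k_subsets n k"
  using diagram_eq_diagram_of diagram_of[OF _ T] by (auto simp: image_iff) metis+

lemma comp_in_diagrams_with_bottom_set:
  assumes "d \<in> planar_rook_monoid n" "a \<in> {a \<in> planar_rook_monoid n. diagram_rank a = k \<and> bottom_set a = T}"
    "fst ` a \<subseteq> bottom_set d"
  shows "d O a \<in> {a \<in> planar_rook_monoid n. diagram_rank a = k \<and> bottom_set a = T}"
  using assms diagram_rank_comp planar_rook_monoid_comp bottom_set_comp by simp

text \<open>The common source of all isomorphisms with \<open>V_module n k\<close>. For any vector \<open>v\<close> of any module,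
  \<open>S \<mapsto> alternating_act (diagram_of S T) v\<close> extends to a homomorphism, because alternating sums and
  the basis of \<open>V_module n k\<close> are moved in the same way and annihilated under the same conditions by a diagram.
  As \<open>V_module n k\<close> is irreducible, the homomorphism is injective as soon as it is nonzero.\<close>

lemma (in planar_rook_module) V_isomorphic_span_alternating_act:
  assumes T: "T \<in> k_subsets n k" and v: "v \<in> M"
    and a: "a \<in> planar_rook_monoid n" "diagram_rank a = k" "bottom_set a = T" "alternating_act a v \<noteq> 0"
  shows "isomorphic_modules n cscale (V_module n k) V_act scl
    (span ((\<lambda>a. alternating_act a v) ` {a \<in> planar_rook_monoid n. diagram_rank a = k \<and> bottom_set a = T})) act"
    (is "isomorphic_modules n cscale ?V V_act scl ?N act")
proof -
  define \<phi> where "\<phi> = lift_basis scl (\<lambda>S. alternating_act (diagram_of S T) v)"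
  interpret \<phi>: Vector_Spaces.linear cscale scl \<phi>
    unfolding \<phi>_def by (rule linear_lift_basis) (rule vector_space_axioms)
  have \<phi>_basis: "\<phi> (basis_vector S) = alternating_act (diagram_of S T) v" for S
    by (simp add: \<phi>_def vector_space_axioms)
  have image: "\<phi> ` ?V = ?N"
    unfolding V_module_def free_cspace_eq_span diagrams_with_bottom_set[OF T]
    by (simp add: \<phi>.span_image[symmetric] image_image \<phi>_basis)
  have "?N \<subseteq> M"
    using alternating_act_closed v by (intro span_minimal subspace_carrier) auto
  then have in_M: "\<phi> f \<in> M" if "f \<in> ?V" for f
    using that image by auto
  have hom: "\<phi> (V_act d f) = act d (\<phi> f)" if d: "d \<in> planar_rook_monoid n" and "f \<in> ?V" for d f
    using \<open>f \<in> ?V\<close> unfolding V_module_def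
  proof (induction rule: free_cspace_induct)
    case zero
    then show ?case
      using V_act_zero[of d]
      by (simp add: \<phi>.zero act_zero d)
  next
    case (step c S g)
    interpret Vd: Vector_Spaces.linear cscale cscale "V_act d" by (rule linear_V_act)
    have ST: "diagram_of S T \<in> planar_rook_monoid n" "fst ` diagram_of S T = S"
      using diagram_of[OF step(1) T] by auto
    have "\<phi> (V_act d (basis_vector S)) = act d (\<phi> (basis_vector S))"
    proof (cases "S \<subseteq> bottom_set d")
      case True
      then show ?thesis
        using act_alternating_act[OF d ST(1) v] ST(2) comp_diagram_of[OF d step(1) True T]
        by (simp add: V_act_basis_vector V_generator_act_def \<phi>_basis)
    next
      case False
      then show ?thesis
        using act_alternating_act_eq_0[OF d ST(1) v] ST(2)
        by (simp add: V_act_basis_vector V_generator_act_def \<phi>_basis \<phi>.zero)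
    qed
    moreover have "\<phi> (basis_vector S) \<in> M" "\<phi> g \<in> M"
      using in_M step by (auto simp: V_module_def basis_vector_in_free_cspace)
    ultimately show ?case
      using step d
      by (simp add: Vd.add Vd.scale \<phi>.add \<phi>.scale act_add act_scale subspace_scale[OF subspace_carrier])
  qed
  \<comment> \<open>The kernel is invariant, hence trivial or everything, and it does not contain the basis vector at the top set of \<open>a\<close>.\<close>
  have "inj_on \<phi> ?V"
  proof -
    let ?K = "{f \<in> ?V. \<phi> f = 0}"
    have sub_V: "cspace.subspace ?V" by (simp add: V_module_def subspace_free_cspace)
    have "invariant_subspace n cscale ?V V_act ?K"
      unfolding invariant_subspace_def
    proof (intro conjI ballI)
      show "cspace.subspace ?K"
        using sub_V by (auto intro!: cspace.subspaceI simp: \<phi>.zero \<phi>.add \<phi>.scale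
            cspace.subspace_0 cspace.subspace_add cspace.subspace_scale)
      show "V_act d f \<in> ?K" if "d \<in> planar_rook_monoid n" "f \<in> ?K" for d f
        using that hom planar_rook_module.act_closed[OF V_planar_rook_module] act_zero by auto
    qed auto
    moreover have "k \<le> n"
      using a(1,2) diagram_rank_le by auto
    ultimately have "?K = {0} \<or> ?K = ?V"
      using V_module_irreducible[of k n] by (simp add: irreducible_module_def)
    moreover have "basis_vector (fst ` a) \<in> ?V" "\<phi> (basis_vector (fst ` a)) \<noteq> 0"
      using a diagram_eq_diagram_of[OF a(1)] by (auto simp: \<phi>_basis V_module_def basis_vector_in_free_cspace)
    ultimately have K: "?K = {0}" by auto
    show ?thesis
    proof (rule inj_onI)
      fix f g assume "f \<in> ?V" "g \<in> ?V" "\<phi> f = \<phi> g"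
      then have "f - g \<in> ?K"
        using sub_V by (simp add: \<phi>.diff cspace.subspace_diff)
      then show "f = g" using K by simp
    qed
  qed
  then have "bij_betw \<phi> ?V ?N"
    using image by (simp add: bij_betw_def)
  then show ?thesis
    unfolding isomorphic_modules_def using hom by (intro exI[of _ \<phi>]) (simp add: \<phi>.add \<phi>.scale)
qed

text \<open>A nonzero vector \<open>v\<close> is a combination of its alternating sums, so one of them is nonzero. It
  determines a nonzero homomorphism from some \<open>V_module n k\<close>, and irreducibility of the target makes
  it surjective.\<close>

lemma irreducible_module_isomorphic_V:
  assumes "irreducible_module n scl M act"
  shows "\<exists>k\<in>{0..n}. isomorphic_modules n scl M act cscale (V_module n k) V_act"
proof -
  interpret planar_rook_module n scl M act
    using assms by (simp add: irreducible_module_def)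
  obtain v where v: "v \<in> M" "v \<noteq> 0"
    using assms zero_in_carrier by (auto simp: irreducible_module_def)
  obtain a where a: "a \<subseteq> Id_on {1..n}" "alternating_act a v \<noteq> 0"
  proof (rule ccontr)
    assume "\<not> thesis"
    then have "(\<lambda>a. alternating_act a v) ` Pow (Id_on {1..n}) \<subseteq> {0}"
      using that by auto
    then have "span ((\<lambda>a. alternating_act a v) ` Pow (Id_on {1..n})) \<subseteq> {0}"
      by (intro span_minimal) auto
    then show False
      using act_in_span_alternating_act[OF planar_rook_monoid_Id v(1)] act_unit[OF v(1)] v(2) by auto
  qed
  have a_P: "a \<in> planar_rook_monoid n"
    using a(1) planar_rook_monoid_Id planar_rook_monoid_subset by blast
  define k where "k = diagram_rank a"
  define T where "T = bottom_set a"
  have T: "T \<in> k_subsets n k"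
    using diagram_eq_diagram_of[OF a_P] by (simp add: T_def k_def)
  let ?A = "{a \<in> planar_rook_monoid n. diagram_rank a = k \<and> bottom_set a = T}"
  let ?N = "span ((\<lambda>a. alternating_act a v) ` ?A)"
  have "invariant_subspace n scl M act ?N"
    using v(1) comp_in_diagrams_with_bottom_set by (intro invariant_span_alternating_act) auto
  then have "?N = {0} \<or> ?N = M"
    using assms by (simp add: irreducible_module_def)
  moreover have "alternating_act a v \<in> ?N"
    using a_P by (intro span_base) (auto simp: k_def T_def)
  ultimately have "?N = M"
    using a(2) by auto
  then have "isomorphic_modules n cscale (V_module n k) V_act scl M act"
    using V_isomorphic_span_alternating_act[OF T v(1) a_P _ _ a(2)] by (simp add: k_def T_def)
  then show ?thesis
    using planar_rook_module.isomorphic_sym[OF V_planar_rook_module] diagram_rank_le[OF a_P] k_def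
    by (intro bexI[of _ k]) simp_all
qed


section \<open>Direct sums\<close>

text \<open>The component of a vector in \<open>span (C i)\<close> is determined by the coefficients of the vector at the
  elements of \<open>C i\<close>, as the other components have coefficient \<open>0\<close> there.\<close>

lemma (in vector_space) internal_direct_sum_span:
  assumes indep: "independent B" and "finite I" and B: "B = (\<Union>i\<in>I. C i)"
    and disj: "disjoint_family_on C I"
  shows "internal_direct_sum (span B) I (\<lambda>i. span (C i))"
  unfolding internal_direct_sum_def bij_betw_def
proof (intro conjI)
  let ?S = "\<lambda>u. \<Sum>i\<in>I. u i" and ?U = "\<Pi>\<^sub>E i\<in>I. span (C i)"
  have sub: "span (C i) \<subseteq> span B" if "i \<in> I" for i
    using that B by (intro span_mono) auto
  have rep: "representation B (u i) b = (if b \<in> C i then representation B (\<Sum>j\<in>I. u j) b else 0)"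
    if u: "u \<in> ?U" and i: "i \<in> I" for u i b
  proof -
    have outside: "representation B (u j) b = 0" if "j \<in> I" "b \<notin> C j" for j
    proof -
      have "u j \<in> span (C j)" "C j \<subseteq> B"
        using u B that by auto
      then have "representation B (u j) = representation (C j) (u j)"
        by (intro representation_extend indep)
      then show ?thesis
        using representation_ne_zero[of "C j" "u j" b] that by auto
    qed
    have "representation B (\<Sum>j\<in>I. u j) b = (\<Sum>j\<in>I. representation B (u j) b)"
      using u sub by (subst representation_sum[OF indep]) auto
    also have "\<dots> = representation B (u i) b" if "b \<in> C i"
    proof -
      have "(\<Sum>j\<in>I. representation B (u j) b) = (\<Sum>j\<in>{i}. representation B (u j) b)"
        using \<open>finite I\<close> i disj that
        by (intro sum.mono_neutral_right) (auto intro!: outside simp: disjoint_family_on_def)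
      then show ?thesis by simp
    qed
    finally show ?thesis
      using outside[OF i] by auto
  qed
  show "inj_on ?S ?U"
  proof (rule inj_onI)
    fix u u' assume u: "u \<in> ?U" "u' \<in> ?U" and eq: "?S u = ?S u'"
    show "u = u'"
    proof (rule PiE_ext[OF u])
      fix i assume i: "i \<in> I"
      then have "u i \<in> span B" "u' i \<in> span B"
        using u sub by blast+
      moreover have "representation B (u i) = representation B (u' i)"
        using rep[OF u(1) i] rep[OF u(2) i] eq by auto
      ultimately show "u i = u' i"
        using sum_nonzero_representation_eq[OF indep] by metis
    qed
  qed
  show "?S ` ?U = span B"
  proof
    show "?S ` ?U \<subseteq> span B"
      using sub by (auto intro!: span_sum)
    show "span B \<subseteq> ?S ` ?U"
    proof
      fix m assume "m \<in> span B"
      then show "m \<in> ?S ` ?U"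
      proof (induction rule: span_induct_alt)
        case base
        show ?case
          by (rule image_eqI[of _ _ "\<lambda>i\<in>I. 0"]) (auto simp: span_zero)
      next
        case (step c x y)
        then obtain u i where u: "u \<in> ?U" "y = ?S u" and i: "i \<in> I" "x \<in> C i"
          using B by auto
        let ?u = "u(i := scale c x + u i)"
        have "u i \<in> span (C i)" using u i by auto
        then have "?u \<in> ?U"
          using u i by (auto simp: PiE_iff extensional_def intro: span_add span_scale span_base)
        moreover have "?S ?u = scale c x + ?S u"
          using \<open>finite I\<close> i by (simp add: sum.remove[of I i] add.assoc)
        ultimately show ?case
          using u by (metis image_eqI)
      qed
    qed
  qed
qed (fact assms)

text \<open>The isomorphism is built from the external sum to \<open>M\<close>, as the sum of the given isomorphisms, where
  compatibility with the operations is immediate; in the other direction it would rest on the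
  uniqueness of decompositions.\<close>

lemma (in planar_rook_module) external_direct_sum_isomorphic:
  assumes sum: "internal_direct_sum M I U"
    and sub: "\<And>i. i \<in> I \<Longrightarrow> U i \<subseteq> M"
    and X: "\<And>i. i \<in> I \<Longrightarrow> planar_rook_module n scl' (X i) act'"
    and iso: "\<And>i. i \<in> I \<Longrightarrow> isomorphic_modules n scl' (X i) act' scl (U i) act"
  shows "isomorphic_modules n scl M act (sum_scale scl') (external_direct_sum I X) (sum_act act')"
proof -
  let ?E = "external_direct_sum I X"
  have fin: "finite I" and sum_bij: "bij_betw (\<lambda>u. \<Sum>i\<in>I. u i) (\<Pi>\<^sub>E i\<in>I. U i) M"
    using sum by (auto simp: internal_direct_sum_def)
  let ?iso = "\<lambda>i \<phi>. bij_betw \<phi> (X i) (U i) \<and>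
      (\<forall>v\<in>X i. \<forall>w\<in>X i. \<phi> (v + w) = \<phi> v + \<phi> w) \<and> (\<forall>c. \<forall>v\<in>X i. \<phi> (scl' c v) = scl c (\<phi> v)) \<and>
      (\<forall>d\<in>planar_rook_monoid n. \<forall>v\<in>X i. \<phi> (act' d v) = act d (\<phi> v))"
  have "\<forall>i\<in>I. \<exists>\<phi>. ?iso i \<phi>"
    using iso by (simp only: isomorphic_modules_def) simp
  from bchoice[OF this] obtain \<psi> where "\<forall>i\<in>I. ?iso i (\<psi> i)" by (rule exE)
  then have \<psi>: "\<And>i. i \<in> I \<Longrightarrow> bij_betw (\<psi> i) (X i) (U i)"
      "\<And>i v w. \<lbrakk>i \<in> I; v \<in> X i; w \<in> X i\<rbrakk> \<Longrightarrow> \<psi> i (v + w) = \<psi> i v + \<psi> i w"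
      "\<And>i c v. \<lbrakk>i \<in> I; v \<in> X i\<rbrakk> \<Longrightarrow> \<psi> i (scl' c v) = scl c (\<psi> i v)"
      "\<And>i d v. \<lbrakk>i \<in> I; d \<in> planar_rook_monoid n; v \<in> X i\<rbrakk> \<Longrightarrow> \<psi> i (act' d v) = act d (\<psi> i v)"
    by simp_all
  have zero: "scl' c 0 = 0" "d \<in> planar_rook_monoid n \<Longrightarrow> act' d 0 = 0" if "i \<in> I" for i c d
  proof -
    interpret X: planar_rook_module n scl' "X i" act' using X[OF that] .
    show "scl' c 0 = 0" "d \<in> planar_rook_monoid n \<Longrightarrow> act' d 0 = 0" by (simp_all add: X.act_zero)
  qed
  have X_closed: "0 \<in> X i" "\<lbrakk>v \<in> X i; w \<in> X i\<rbrakk> \<Longrightarrow> v + w \<in> X i" "v \<in> X i \<Longrightarrow> scl' c v \<in> X i"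
    "\<lbrakk>d \<in> planar_rook_monoid n; v \<in> X i\<rbrakk> \<Longrightarrow> act' d v \<in> X i" if "i \<in> I" for i v w c d
  proof -
    interpret X: planar_rook_module n scl' "X i" act' using X[OF that] .
    show "0 \<in> X i" "\<lbrakk>v \<in> X i; w \<in> X i\<rbrakk> \<Longrightarrow> v + w \<in> X i" "v \<in> X i \<Longrightarrow> scl' c v \<in> X i"
      "\<lbrakk>d \<in> planar_rook_monoid n; v \<in> X i\<rbrakk> \<Longrightarrow> act' d v \<in> X i"
      using X.subspace_carrier by (auto intro: X.subspace_0 X.subspace_add X.subspace_scale X.act_closed)
  qed
  have E_iff: "g \<in> ?E \<longleftrightarrow> (\<forall>i. if i \<in> I then Poly_Mapping.lookup g i \<in> X i else Poly_Mapping.lookup g i = 0)" for g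
    by (auto simp: external_direct_sum_def in_keys_iff subset_iff)
  have lookup_scale: "Poly_Mapping.lookup (sum_scale scl' c g) i = scl' c (Poly_Mapping.lookup g i)"
    if "i \<in> I" for c g i
    using zero(1)[OF that] by (simp add: sum_scale_def Poly_Mapping.map.rep_eq when_def)
  have lookup_act: "Poly_Mapping.lookup (sum_act act' d g) i = act' d (Poly_Mapping.lookup g i)"
    if "i \<in> I" "d \<in> planar_rook_monoid n" for d g i
    using zero(2)[OF that] by (simp add: sum_act_def Poly_Mapping.map.rep_eq when_def)
  define family_of where "family_of g = (\<lambda>i\<in>I. \<psi> i (Poly_Mapping.lookup g i))" for g
  define assemble where
    "assemble u = Abs_poly_mapping (\<lambda>i. if i \<in> I then inv_into (X i) (\<psi> i) (u i) else 0)" for u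
  have lookup_assemble: "Poly_Mapping.lookup (assemble u) i = (if i \<in> I then inv_into (X i) (\<psi> i) (u i) else 0)" for u i
    unfolding assemble_def
    by (subst lookup_Abs_poly_mapping) (auto intro: finite_subset[OF _ fin] split: if_splits)
  have family_of_bij: "bij_betw family_of ?E (\<Pi>\<^sub>E i\<in>I. U i)"
  proof (rule bij_betwI[of _ _ _ assemble])
    show "family_of \<in> ?E \<rightarrow> (\<Pi>\<^sub>E i\<in>I. U i)"
    proof
      fix g assume "g \<in> ?E"
      then have "\<psi> i (Poly_Mapping.lookup g i) \<in> U i" if "i \<in> I" for i
        using bij_betw_apply[OF \<psi>(1)[OF that]] that by (simp add: E_iff)
      then show "family_of g \<in> (\<Pi>\<^sub>E i\<in>I. U i)" by (simp add: family_of_def)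
    qed
    show "assemble \<in> (\<Pi>\<^sub>E i\<in>I. U i) \<rightarrow> ?E"
    proof
      fix u assume u: "u \<in> (\<Pi>\<^sub>E i\<in>I. U i)"
      have "inv_into (X i) (\<psi> i) (u i) \<in> X i" if "i \<in> I" for i
        using bij_betw_apply[OF bij_betw_inv_into[OF \<psi>(1)[OF that]]] u that by auto
      then show "assemble u \<in> ?E" by (simp add: E_iff lookup_assemble)
    qed
    show "assemble (family_of g) = g" if "g \<in> ?E" for g
      using that \<psi>(1)
      by (intro poly_mapping_eqI) (auto simp: lookup_assemble family_of_def E_iff intro: bij_betw_inv_into_left split: if_splits)
    show "family_of (assemble u) = u" if "u \<in> (\<Pi>\<^sub>E i\<in>I. U i)" for u
      using that \<psi>(1)
      by (auto simp: family_of_def lookup_assemble fun_eq_iff PiE_iff extensional_def intro: bij_betw_inv_into_right)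
  qed
  have in_M: "\<psi> i (Poly_Mapping.lookup g i) \<in> M" if "g \<in> ?E" "i \<in> I" for g i
    using bij_betw_apply[OF \<psi>(1)[OF that(2)]] that sub[OF that(2)] by (auto simp: E_iff)
  define \<Psi> where "\<Psi> g = (\<Sum>i\<in>I. \<psi> i (Poly_Mapping.lookup g i))" for g
  have "bij_betw ((\<lambda>u. \<Sum>i\<in>I. u i) \<circ> family_of) ?E M"
    by (rule bij_betw_trans[OF family_of_bij sum_bij])
  also have "(\<lambda>u. \<Sum>i\<in>I. u i) \<circ> family_of = \<Psi>"
    by (auto simp: \<Psi>_def family_of_def)
  finally have "bij_betw \<Psi> ?E M" .
  moreover have "\<Psi> (f + g) = \<Psi> f + \<Psi> g" if "f \<in> ?E" "g \<in> ?E" for f g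
    using that by (simp add: \<Psi>_def E_iff lookup_add \<psi>(2) flip: sum.distrib cong: sum.cong)
  moreover have "\<Psi> (sum_scale scl' c g) = scl c (\<Psi> g)" if "g \<in> ?E" for c g
    using that by (simp add: \<Psi>_def E_iff lookup_scale \<psi>(3) scale_sum_right cong: sum.cong)
  moreover have "\<Psi> (sum_act act' d g) = act d (\<Psi> g)" if "d \<in> planar_rook_monoid n" "g \<in> ?E" for d g
    using that in_M[OF that(2)]
    by (simp add: \<Psi>_def E_iff lookup_act \<psi>(4) act_sum cong: sum.cong)
  ultimately have "isomorphic_modules n (sum_scale scl') ?E (sum_act act') scl M act"
    unfolding isomorphic_modules_def by blast
  then show ?thesis
  proof (rule isomorphic_modules_sym[rotated 3])
    show "f + g \<in> ?E" if "f \<in> ?E" "g \<in> ?E" for f g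
      using that X_closed by (simp add: E_iff lookup_add)
    show "sum_scale scl' c g \<in> ?E" if "g \<in> ?E" for c g
      using that X_closed by (simp add: E_iff lookup_scale) (simp add: sum_scale_def Poly_Mapping.map.rep_eq)
    show "sum_act act' d g \<in> ?E" if "d \<in> planar_rook_monoid n" "g \<in> ?E" for d g
      using that X_closed by (simp add: E_iff lookup_act) (simp add: sum_act_def Poly_Mapping.map.rep_eq)
  qed
qed


section \<open>The planar rook algebra\<close>

lemma left_act_eq: "left_act = (\<lambda>d. linear_extension (\<lambda>a. basis_vector (d O a)))"
  by (intro ext)
    (simp add: left_act_def algebra_mult_def linear_extension_eq_lift_basis cspace.vector_space_axioms)

lemma left_act_basis_vector: "left_act d (basis_vector a) = basis_vector (d O a)"
  by (simp add: left_act_eq linear_extension_eq_lift_basis cspace.vector_space_axioms)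

lemma planar_rook_algebra_module: "planar_rook_module n cscale (planar_rook_algebra n) left_act"
  unfolding planar_rook_algebra_def left_act_eq
proof (rule free_planar_rook_module)
  show "linear_extension (\<lambda>a. basis_vector (d1 O a)) (basis_vector (d2 O b)) = basis_vector ((d1 O d2) O b)"
    for d1 d2 b :: diagram
    using left_act_basis_vector[of d1 "d2 O b"] by (simp add: left_act_eq O_assoc)
qed (simp_all only: planar_rook_monoid_comp basis_vector_in_free_cspace Id_diagram_comp)

interpretation algebra: planar_rook_module n cscale "planar_rook_algebra n" left_act for n
  by (rule planar_rook_algebra_module)

lemma one_in_planar_rook_algebra: "basis_vector (Id_on {1..n}) \<in> planar_rook_algebra n"
  unfolding planar_rook_algebra_def by (rule basis_vector_in_free_cspace[OF planar_rook_monoid_Id])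

lemma x_elem_eq_alternating_act:
  assumes "a \<in> planar_rook_monoid n"
  shows "x_elem n a = algebra.alternating_act a (basis_vector (Id_on {1..n}))"
proof -
  have sub: "b \<in> planar_rook_monoid n" if "b \<subseteq> a" for b
    using planar_rook_monoid_subset assms that .
  then have "{b. b \<in> planar_rook_monoid n \<and> b \<subseteq> a} = Pow a" by auto
  moreover have "b O Id_on {1..n} = b" if "b \<in> Pow a" for b
    using diagram_comp_Id sub that by auto
  ultimately show ?thesis
    by (simp add: x_elem_def algebra.alternating_act_def left_act_basis_vector)
qed

lemma lookup_x_elem:
  assumes "a \<in> planar_rook_monoid n"
  shows "Poly_Mapping.lookup (x_elem n a) b = (if b \<subseteq> a then (- 1) ^ (card a - card b) else 0)"
proof -
  have P: "{b. b \<in> planar_rook_monoid n \<and> b \<subseteq> a} = Pow a"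
    using planar_rook_monoid_subset[OF assms] by auto
  have "finite (Pow a)"
    using finite_diagram[OF assms] by simp
  then show ?thesis
    by (simp add: x_elem_def P lookup_sum lookup_single when_def if_distrib sum.delta cong: if_cong)
qed

lemma inj_on_x_elem: "inj_on (x_elem n) (planar_rook_monoid n)"
proof (rule inj_onI)
  fix a b assume ab: "a \<in> planar_rook_monoid n" "b \<in> planar_rook_monoid n" "x_elem n a = x_elem n b"
  have "Poly_Mapping.lookup (x_elem n b) a \<noteq> 0" "Poly_Mapping.lookup (x_elem n a) b \<noteq> 0"
    using ab lookup_x_elem[OF ab(1), of a] lookup_x_elem[OF ab(2), of b] by simp_all
  then show "a = b"
    using lookup_x_elem[OF ab(1), of b] lookup_x_elem[OF ab(2), of a] by (auto split: if_splits)
qed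

text \<open>The family is unitriangular with respect to the basis of diagrams: if \<open>a\<close> has maximal rank among
  the diagrams with nonzero coefficient in a linear relation, then the basis vector of \<open>a\<close> occurs in
  the term of \<open>a\<close> but in no other term.\<close>

lemma independent_x_elem: "cspace.independent (x_elem n ` planar_rook_monoid n)"
proof
  let ?P = "planar_rook_monoid n"
  assume "cspace.dependent (x_elem n ` ?P)"
  then obtain u where "\<exists>v\<in>x_elem n ` ?P. u v \<noteq> 0" and "(\<Sum>v\<in>x_elem n ` ?P. cscale (u v) v) = 0"
    by (auto simp: cspace.dependent_finite finite_planar_rook_monoid)
  then have sum: "(\<Sum>a\<in>?P. cscale (u (x_elem n a)) (x_elem n a)) = 0"
    and "{a \<in> ?P. u (x_elem n a) \<noteq> 0} \<noteq> {}" (is "?A \<noteq> {}")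
    by (auto simp: sum.reindex[OF inj_on_x_elem])
  have fin: "finite ?A"
    using finite_planar_rook_monoid by simp
  with \<open>?A \<noteq> {}\<close> have "Max (card ` ?A) \<in> card ` ?A"
    by (intro Max_in) simp_all
  then obtain a where a: "a \<in> ?A" and "Max (card ` ?A) = card a"
    by (rule imageE)
  then have max: "card b \<le> card a" if "b \<in> ?A" for b
    using Max_ge[of "card ` ?A" "card b"] fin that by simp
  have "Poly_Mapping.lookup (cscale (u (x_elem n b)) (x_elem n b)) a = 0" if b: "b \<in> ?P - {a}" for b
  proof (cases "a \<subseteq> b \<and> b \<in> ?A")
    case True
    then have "card a < card b"
      using b finite_diagram[of b n] by (auto intro: psubset_card_mono)
    then show ?thesis using max[of b] True by simp
  next
    case False
    then show ?thesis using b lookup_x_elem[of b n a] by auto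
  qed
  then have "(\<Sum>b\<in>?P - {a}. Poly_Mapping.lookup (cscale (u (x_elem n b)) (x_elem n b)) a) = 0"
    by (intro sum.neutral ballI)
  then have "(\<Sum>b\<in>?P. Poly_Mapping.lookup (cscale (u (x_elem n b)) (x_elem n b)) a)
      = Poly_Mapping.lookup (cscale (u (x_elem n a)) (x_elem n a)) a"
    using a finite_planar_rook_monoid[of n] by (subst sum.remove[of _ a]) simp_all
  moreover have "(\<Sum>b\<in>?P. Poly_Mapping.lookup (cscale (u (x_elem n b)) (x_elem n b)) a) = 0"
    using arg_cong[OF sum, of "\<lambda>f. Poly_Mapping.lookup f a"] by (simp add: lookup_sum)
  ultimately show False
    using a lookup_x_elem[of a n a] by simp
qed

lemma span_x_elem: "cspace.span (x_elem n ` planar_rook_monoid n) = planar_rook_algebra n"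
proof
  show "cspace.span (x_elem n ` planar_rook_monoid n) \<subseteq> planar_rook_algebra n"
  proof (intro cspace.span_minimal algebra.subspace_carrier image_subsetI)
    show "x_elem n a \<in> planar_rook_algebra n" if "a \<in> planar_rook_monoid n" for a
      unfolding x_elem_eq_alternating_act[OF that]
      by (rule algebra.alternating_act_closed[OF that one_in_planar_rook_algebra])
  qed
  show "planar_rook_algebra n \<subseteq> cspace.span (x_elem n ` planar_rook_monoid n)"
    unfolding planar_rook_algebra_def free_cspace_eq_span
  proof (intro cspace.span_minimal cspace.subspace_span, safe)
    fix d assume d: "d \<in> planar_rook_monoid n"
    have P: "Pow d \<subseteq> planar_rook_monoid n"
      using planar_rook_monoid_subset[OF d] by auto
    have "basis_vector d = left_act d (basis_vector (Id_on {1..n}))"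
      unfolding left_act_basis_vector diagram_comp_Id[OF d] ..
    also have "\<dots> \<in> cspace.span ((\<lambda>a. algebra.alternating_act a (basis_vector (Id_on {1..n}))) ` Pow d)"
      by (rule algebra.act_in_span_alternating_act[OF d one_in_planar_rook_algebra])
    also have "(\<lambda>a. algebra.alternating_act a (basis_vector (Id_on {1..n}))) ` Pow d = x_elem n ` Pow d"
      using P by (intro image_cong refl) (auto simp: x_elem_eq_alternating_act)
    also have "cspace.span (x_elem n ` Pow d) \<subseteq> cspace.span (x_elem n ` planar_rook_monoid n)"
      using P by (intro cspace.span_mono image_mono)
    finally show "basis_vector d \<in> cspace.span (x_elem n ` planar_rook_monoid n)" .
  qed
qed

lemma W_space_eq:
  "W_space n k = cspace.span (x_elem n ` {a \<in> planar_rook_monoid n. diagram_rank a = k})"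
  by (simp add: W_space_def setcompr_eq_image)

lemma W_bottom_space_eq: "W_bottom_space n k T =
  cspace.span (x_elem n ` {a \<in> planar_rook_monoid n. diagram_rank a = k \<and> bottom_set a = T})"
  by (simp add: W_bottom_space_def setcompr_eq_image)

lemma invariant_span_x_elem:
  assumes "A \<subseteq> planar_rook_monoid n"
    and "\<And>d a. \<lbrakk>d \<in> planar_rook_monoid n; a \<in> A; fst ` a \<subseteq> bottom_set d\<rbrakk> \<Longrightarrow> d O a \<in> A"
  shows "invariant_subspace n cscale (planar_rook_algebra n) left_act (cspace.span (x_elem n ` A))"
proof -
  have "x_elem n ` A = (\<lambda>a. algebra.alternating_act a (basis_vector (Id_on {1..n}))) ` A"
    using assms(1) by (intro image_cong refl) (auto simp: x_elem_eq_alternating_act)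
  then show ?thesis
    using algebra.invariant_span_alternating_act[OF one_in_planar_rook_algebra assms] by simp
qed

lemma W_space_invariant: "invariant_subspace n cscale (planar_rook_algebra n) left_act (W_space n k)"
  unfolding W_space_eq
  by (rule invariant_span_x_elem) (auto simp: planar_rook_monoid_comp diagram_rank_comp)

lemma W_bottom_space_invariant:
  "invariant_subspace n cscale (planar_rook_algebra n) left_act (W_bottom_space n k T)"
  unfolding W_bottom_space_eq
  using comp_in_diagrams_with_bottom_set by (intro invariant_span_x_elem) auto

lemma internal_direct_sum_x_elem:
  assumes "B \<subseteq> planar_rook_monoid n" "finite I" and B: "B = (\<Union>i\<in>I. C i)" and "disjoint_family_on C I"
  shows "internal_direct_sum (cspace.span (x_elem n ` B)) I (\<lambda>i. cspace.span (x_elem n ` C i))"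
proof (rule cspace.internal_direct_sum_span)
  show "cspace.independent (x_elem n ` B)"
    using independent_x_elem assms(1) by (rule cspace.independent_mono[OF _ image_mono])
  show "x_elem n ` B = (\<Union>i\<in>I. x_elem n ` C i)"
    using B by auto
  show "disjoint_family_on (\<lambda>i. x_elem n ` C i) I"
    unfolding disjoint_family_on_def
  proof (intro ballI impI)
    fix i j assume ij: "i \<in> I" "j \<in> I" "i \<noteq> j"
    then have "C i \<subseteq> planar_rook_monoid n" "C j \<subseteq> planar_rook_monoid n" "C i \<inter> C j = {}"
      using assms by (auto simp: disjoint_family_on_def)
    then show "x_elem n ` C i \<inter> x_elem n ` C j = {}"
      using inj_on_image_Int[OF inj_on_x_elem] by (metis image_empty)
  qed
qed (fact assms)

lemma algebra_sum_W_space: "internal_direct_sum (planar_rook_algebra n) {0..n} (W_space n)"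
proof -
  have "internal_direct_sum (cspace.span (x_elem n ` planar_rook_monoid n)) {0..n}
    (\<lambda>k. cspace.span (x_elem n ` {a \<in> planar_rook_monoid n. diagram_rank a = k}))"
    by (rule internal_direct_sum_x_elem) (auto simp: diagram_rank_le disjoint_family_on_def)
  then show ?thesis
    by (simp add: span_x_elem W_space_eq[abs_def])
qed

lemma W_space_sum_W_bottom_space: "internal_direct_sum (W_space n k) (k_subsets n k) (W_bottom_space n k)"
proof -
  have "internal_direct_sum (cspace.span (x_elem n ` {a \<in> planar_rook_monoid n. diagram_rank a = k}))
    (k_subsets n k) (\<lambda>T. cspace.span (x_elem n ` {a \<in> planar_rook_monoid n. diagram_rank a = k \<and> bottom_set a = T}))"
    using diagram_eq_diagram_of(3)
    by (intro internal_direct_sum_x_elem) (auto simp: finite_k_subsets disjoint_family_on_def)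
  then show ?thesis
    by (simp add: W_space_eq W_bottom_space_eq[abs_def])
qed

text \<open>The sets \<open>T\<close> of size \<open>k\<close> are indexed by an arbitrary family, so that the same result serves both
  the decomposition indexed by the sets themselves and the comparison with \<open>n choose k\<close> numbered
  copies of \<open>V_module n k\<close>.\<close>

lemma algebra_sum_W_bottom_space:
  assumes e: "\<And>k. k \<le> n \<Longrightarrow> bij_betw (e k) (J k) (k_subsets n k)"
  shows "internal_direct_sum (planar_rook_algebra n) (SIGMA k:{0..n}. J k)
    (\<lambda>(k, j). W_bottom_space n k (e k j))"
proof -
  let ?C = "\<lambda>(k, j). {a \<in> planar_rook_monoid n. diagram_rank a = k \<and> bottom_set a = e k j}"
  have "internal_direct_sum (cspace.span (x_elem n ` planar_rook_monoid n)) (SIGMA k:{0..n}. J k)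
    (\<lambda>i. cspace.span (x_elem n ` ?C i))"
  proof (rule internal_direct_sum_x_elem)
    show "finite (SIGMA k:{0..n}. J k)"
      using bij_betw_finite[OF e] finite_k_subsets by (intro finite_SigmaI) auto
    show "planar_rook_monoid n = \<Union> (?C ` (SIGMA k:{0..n}. J k))"
    proof (intro equalityI subsetI)
      fix a assume a: "a \<in> planar_rook_monoid n"
      have k: "diagram_rank a \<le> n" using diagram_rank_le[OF a] .
      obtain j where "j \<in> J (diagram_rank a)" "e (diagram_rank a) j = bottom_set a"
        using diagram_eq_diagram_of(3)[OF a] bij_betw_imp_surj_on[OF e[OF k]] by (metis imageE)
      then show "a \<in> \<Union> (?C ` (SIGMA k:{0..n}. J k))"
        using a k by (intro UN_I[of "(diagram_rank a, j)"]) auto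
    qed auto
    show "disjoint_family_on ?C (SIGMA k:{0..n}. J k)"
      using bij_betw_imp_inj_on[OF e] by (auto simp: disjoint_family_on_def) (metis inj_onD)
  qed auto
  moreover have "(\<lambda>i. cspace.span (x_elem n ` ?C i)) = (\<lambda>(k, j). W_bottom_space n k (e k j))"
    by (auto simp: W_bottom_space_eq fun_eq_iff)
  ultimately show ?thesis
    by (simp add: span_x_elem)
qed

text \<open>The homomorphism attached to the unit of the algebra takes the basis vector at \<open>S\<close> to
  \<open>x_elem n (diagram_of S T)\<close>.\<close>

lemma V_module_isomorphic_W_bottom_space:
  assumes T: "T \<in> k_subsets n k"
  shows "isomorphic_modules n cscale (V_module n k) V_act cscale (W_bottom_space n k T) left_act"
proof -
  let ?one = "basis_vector (Id_on {1..n})"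
  have a: "diagram_of T T \<in> planar_rook_monoid n" "diagram_rank (diagram_of T T) = k" "bottom_set (diagram_of T T) = T"
    using diagram_of[OF T T] by auto
  have "x_elem n (diagram_of T T) \<noteq> 0"
    using lookup_x_elem[OF a(1), of "diagram_of T T"] by auto
  then have "algebra.alternating_act (diagram_of T T) ?one \<noteq> 0"
    using x_elem_eq_alternating_act[OF a(1)] by simp
  moreover have "x_elem n ` {a \<in> planar_rook_monoid n. diagram_rank a = k \<and> bottom_set a = T}
    = (\<lambda>a. algebra.alternating_act a ?one) ` {a \<in> planar_rook_monoid n. diagram_rank a = k \<and> bottom_set a = T}"
    by (intro image_cong refl) (auto simp: x_elem_eq_alternating_act)
  ultimately show ?thesis
    using algebra.V_isomorphic_span_alternating_act[OF T one_in_planar_rook_algebra a]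
    by (simp add: W_bottom_space_eq)
qed

lemma algebra_isomorphic_sum_V_modules:
  "isomorphic_modules n cscale (planar_rook_algebra n) left_act (sum_scale cscale)
    (external_direct_sum (SIGMA k:{0..n}. {..<n choose k}) (\<lambda>(k, j). V_module n k)) (sum_act V_act)"
proof -
  have "\<exists>e. bij_betw e {..<n choose k} (k_subsets n k)" for k
    using ex_bij_betw_nat_finite[OF finite_k_subsets, of n k] by (simp add: card_k_subsets lessThan_atLeast0)
  then obtain e where e: "\<And>k. bij_betw (e k) {..<n choose k} (k_subsets n k)"
    by metis
  show ?thesis
  proof (rule algebra.external_direct_sum_isomorphic)
    show "internal_direct_sum (planar_rook_algebra n) (SIGMA k:{0..n}. {..<n choose k})
      (\<lambda>(k, j). W_bottom_space n k (e k j))"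
      using e by (rule algebra_sum_W_bottom_space)
    fix i assume "i \<in> (SIGMA k:{0..n}. {..<n choose k})"
    then obtain k j where i: "i = (k, j)" "e k j \<in> k_subsets n k"
      using bij_betw_apply[OF e] by auto
    show "(case i of (k, j) \<Rightarrow> W_bottom_space n k (e k j)) \<subseteq> planar_rook_algebra n"
      using W_bottom_space_invariant i by (simp add: invariant_subspace_def)
    show "planar_rook_module n cscale (case i of (k, j) \<Rightarrow> V_module n k) V_act"
      using V_planar_rook_module i by simp
    show "isomorphic_modules n cscale (case i of (k, j) \<Rightarrow> V_module n k) V_act cscale
      (case i of (k, j) \<Rightarrow> W_bottom_space n k (e k j)) left_act"
      using V_module_isomorphic_W_bottom_space i by simp
  qed
qed

theorem theorem3p2:
  fixes n :: nat
  shows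
    "\<comment> \<open>(a)\<close>
     planar_rook_module n cscale (planar_rook_algebra n) left_act \<and>
     (\<forall>k\<in>{0..n}. invariant_subspace n cscale (planar_rook_algebra n) left_act (W_space n k)) \<and>
     internal_direct_sum (planar_rook_algebra n) {0..n} (W_space n) \<and>
     (\<forall>k\<in>{0..n}. \<forall>T\<in>k_subsets n k.
        invariant_subspace n cscale (planar_rook_algebra n) left_act (W_bottom_space n k T)) \<and>
     (\<forall>k\<in>{0..n}. internal_direct_sum (W_space n k) (k_subsets n k) (W_bottom_space n k)) \<and>
     internal_direct_sum (planar_rook_algebra n) (SIGMA k:{0..n}. k_subsets n k)
       (\<lambda>(k, T). W_bottom_space n k T) \<and>
     isomorphic_modules n cscale (planar_rook_algebra n) left_act
       (sum_scale cscale)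
       (external_direct_sum (SIGMA k:{0..n}. {..<n choose k}) (\<lambda>(k, j). V_module n k))
       (sum_act V_act) \<and>
     \<comment> \<open>(b)\<close>
     (\<forall>k\<in>{0..n}. irreducible_module n cscale (V_module n k) V_act) \<and>
     (\<forall>k\<in>{0..n}. \<forall>l\<in>{0..n}. k \<noteq> l \<longrightarrow>
        \<not> isomorphic_modules n cscale (V_module n k) V_act cscale (V_module n l) V_act) \<and>
     (\<forall>(scl :: complex \<Rightarrow> 'm :: ab_group_add \<Rightarrow> 'm) M act.
        irreducible_module n scl M act \<longrightarrow>
        (\<exists>k\<in>{0..n}. isomorphic_modules n scl M act cscale (V_module n k) V_act))"
  using algebra_sum_W_bottom_space[of n "\<lambda>k T. T" "k_subsets n"] V_modules_not_isomorphic
  by (intro conjI ballI allI impI planar_rook_algebra_module W_space_invariant algebra_sum_W_space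
      W_bottom_space_invariant W_space_sum_W_bottom_space algebra_isomorphic_sum_V_modules
      V_module_irreducible irreducible_module_isomorphic_V) (auto simp: bij_betw_def)

end
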